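(* Let $L>0$, $T>0$, let $n := \min\{m\in\mathbb{N}: T\le mL\}$ be the number of time slices, and let $w\in [H^1_{,0}(\Sigma)]'$. Then the single layer operator $\mathsf{V}:[H^1_{,0}(\Sigma)]'\to L^2(\Sigma)$ is bounded from below by the constant $\widetilde c_S(n)$, i.e. $$\|\mathsf{V}w\|^2_{L^2(\Sigma)} \ge \widetilde c_S(n)^2\,\|w\|^2_{[H^1_{,0}(\Sigma)]'},\qquad\text{where}\quad \widetilde c_S(n) := \sin\left(\frac{\pi}{2(2n+1)}\right).$$
   Context: All functions are real-valued. $L^2(\Sigma) := L^2(0,T)\times L^2(0,T)$ and $H^1_{,0}(\Sigma) := H^1_{,0}(0,T)\times H^1_{,0}(0,T)$, where $H^1_{,0}(0,T)=\{q\in H^1(0,T): q(T)=0\}$; elements are written $u=(u_0,u_L)$, and $\|u\|^2_{L^2(\Sigma)} = \|u_0\|^2_{L^2(0,T)}+\|u_L\|^2_{L^2(0,T)}$, $\|u\|^2_{H^1_{,0}(\Sigma)} := \|\partial_t u_0\|^2_{L^2(0,T)}+\|\partial_t u_L\|^2_{L^2(0,T)}$. $[H^1_{,0}(\Sigma)]'$ is the dual of $H^1_{,0}(\Sigma)$ with respect to $L^2(\Sigma)$ (the duality pairing $\langle\cdot,\cdot\rangle_\Sigma$ extends the $L^2(\Sigma)$ inner product, so $L^2(\Sigma)\subset [H^1_{,0}(\Sigma)]'$), with norm $$\|w\|_{[H^1_{,0}(\Sigma)]'} = \sup_{0\neq v\in H^1_{,0}(\Sigma)}\frac{\langle w,v\rangle_\Sigma}{\|v\|_{H^1_{,0}(\Sigma)}}.$$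 The single layer boundary integral operator of the wave equation on $(0,L)\times(0,T)$ is, for $w=(w_0,w_L)\in L^2(\Sigma)$ and $t\in(0,T)$, $$(\mathsf{V}w)(t) = \begin{pmatrix} \frac12\int_0^t w_0(s)\,ds + \frac12\int_0^{t-L} w_L(s)\,ds\\[1mm] \frac12\int_0^{t-L} w_0(s)\,ds+\frac12\int_0^t w_L(s)\,ds\end{pmatrix},$$ where integrals $\int_0^{t-L}$ are understood as $0$ for $t\le L$. $\mathsf{V}:[H^1_{,0}(\Sigma)]'\to L^2(\Sigma)$ denotes its continuous extension. *)

theory Defs
  imports "HOL-Analysis.Analysis"
begin

text \<open>
  Elements of the function spaces are represented by functions \<^typ>\<open>real \<Rightarrow> real\<close>, of which only
  the values almost everywhere in the open interval $(0,T)$ matter; all notions below are invariant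
  under changes on null sets, so the ``norms'' are seminorms on representatives.
\<close>

abbreviation interval_measure :: "real \<Rightarrow> real measure" where
  "interval_measure T \<equiv> lebesgue_on {0<..<T}"

definition L2 :: "real \<Rightarrow> (real \<Rightarrow> real) set" where
  "L2 T = {f \<in> borel_measurable (interval_measure T). integrable (interval_measure T) (\<lambda>t. (f t)\<^sup>2)}"

definition L2_inner :: "real \<Rightarrow> (real \<Rightarrow> real) \<Rightarrow> (real \<Rightarrow> real) \<Rightarrow> real" where
  "L2_inner T f g = (LINT t|interval_measure T. f t * g t)"

definition L2_norm :: "real \<Rightarrow> (real \<Rightarrow> real) \<Rightarrow> real" where
  "L2_norm T f = sqrt (L2_inner T f f)"

definition test_functions :: "real \<Rightarrow> (real \<Rightarrow> real) set" where
  "test_functions T = {\<phi>. (\<forall>k t. (deriv ^^ k) \<phi> differentiable (at t)) \<and>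
     (\<exists>K. compact K \<and> K \<subseteq> {0<..<T} \<and> (\<forall>t. t \<notin> K \<longrightarrow> \<phi> t = 0))}"

definition has_weak_deriv :: "real \<Rightarrow> (real \<Rightarrow> real) \<Rightarrow> (real \<Rightarrow> real) \<Rightarrow> bool" where
  "has_weak_deriv T q g \<longleftrightarrow>
     (\<forall>\<phi> \<in> test_functions T. L2_inner T q (deriv \<phi>) = - L2_inner T g \<phi>)"

definition H1 :: "real \<Rightarrow> (real \<Rightarrow> real) set" where
  "H1 T = {q \<in> L2 T. \<exists>g \<in> L2 T. has_weak_deriv T q g}"

text \<open>The weak derivative is unique only up to null sets; any choice will do.\<close>

definition weak_deriv :: "real \<Rightarrow> (real \<Rightarrow> real) \<Rightarrow> real \<Rightarrow> real" where
  "weak_deriv T q = (SOME g. g \<in> L2 T \<and> has_weak_deriv T q g)"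

text \<open>The condition $q(T) = 0$ refers to the continuous representative on $[0,T]$.\<close>

definition H1_end :: "real \<Rightarrow> (real \<Rightarrow> real) set" where
  "H1_end T = {q \<in> H1 T. \<exists>c. continuous_on {0..T} c \<and> (AE t in interval_measure T. q t = c t) \<and> c T = 0}"

text \<open>Pairs $u = (u_0, u_L)$ on the lateral boundary.\<close>

type_synonym bdry = "(real \<Rightarrow> real) \<times> (real \<Rightarrow> real)"

definition lincomb :: "real \<Rightarrow> bdry \<Rightarrow> real \<Rightarrow> bdry \<Rightarrow> bdry" where
  "lincomb a u b v = (\<lambda>t. a * fst u t + b * fst v t, \<lambda>t. a * snd u t + b * snd v t)"

definition eq_AE :: "real \<Rightarrow> bdry \<Rightarrow> bdry \<Rightarrow> bool" where
  "eq_AE T u v \<longleftrightarrow> (AE t in interval_measure T. fst u t = fst v t \<and> snd u t = snd v t)"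

definition L2_Sigma :: "real \<Rightarrow> bdry set" where
  "L2_Sigma T = L2 T \<times> L2 T"

definition L2_Sigma_inner :: "real \<Rightarrow> bdry \<Rightarrow> bdry \<Rightarrow> real" where
  "L2_Sigma_inner T u v = L2_inner T (fst u) (fst v) + L2_inner T (snd u) (snd v)"

definition L2_Sigma_norm :: "real \<Rightarrow> bdry \<Rightarrow> real" where
  "L2_Sigma_norm T u = sqrt ((L2_norm T (fst u))\<^sup>2 + (L2_norm T (snd u))\<^sup>2)"

definition H1_Sigma :: "real \<Rightarrow> bdry set" where
  "H1_Sigma T = H1_end T \<times> H1_end T"

definition H1_Sigma_norm :: "real \<Rightarrow> bdry \<Rightarrow> real" where
  "H1_Sigma_norm T u =
     sqrt ((L2_norm T (weak_deriv T (fst u)))\<^sup>2 + (L2_norm T (weak_deriv T (snd u)))\<^sup>2)"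

text \<open>
  The duality pairing of \<open>w\<close> and \<open>v\<close> is the application \<open>w v\<close>. Boundedness forces a functional to
  respect equality almost everywhere; its values outside \<open>H1_Sigma T\<close> are irrelevant.
\<close>

definition dual_Sigma :: "real \<Rightarrow> (bdry \<Rightarrow> real) set" where
  "dual_Sigma T = {w.
     (\<forall>u \<in> H1_Sigma T. \<forall>v \<in> H1_Sigma T. \<forall>a b. w (lincomb a u b v) = a * w u + b * w v) \<and>
     (\<exists>C. \<forall>v \<in> H1_Sigma T. \<bar>w v\<bar> \<le> C * H1_Sigma_norm T v)}"

definition dual_norm :: "real \<Rightarrow> (bdry \<Rightarrow> real) \<Rightarrow> real" where
  "dual_norm T w =
     (SUP v \<in> {v \<in> H1_Sigma T. \<not> eq_AE T v (\<lambda>_. 0, \<lambda>_. 0)}. w v / H1_Sigma_norm T v)"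

text \<open>The embedding of $L^2(\Sigma)$ into the dual space is \<open>w \<mapsto> L2_Sigma_inner T w\<close>.\<close>

definition V_L2 :: "real \<Rightarrow> bdry \<Rightarrow> bdry" where
  "V_L2 L w =
     (\<lambda>t. 1/2 * (LINT s|lebesgue_on {0<..<t}. fst w s) + 1/2 * (LINT s|lebesgue_on {0<..<t-L}. snd w s),
      \<lambda>t. 1/2 * (LINT s|lebesgue_on {0<..<t-L}. fst w s) + 1/2 * (LINT s|lebesgue_on {0<..<t}. snd w s))"

definition V_extension :: "real \<Rightarrow> real \<Rightarrow> ((bdry \<Rightarrow> real) \<Rightarrow> bdry) \<Rightarrow> bool" where
  "V_extension L T V \<longleftrightarrow>
     (\<forall>w \<in> dual_Sigma T. V w \<in> L2_Sigma T) \<and>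
     (\<forall>w \<in> dual_Sigma T. \<forall>z \<in> dual_Sigma T. \<forall>a b.
        eq_AE T (V (\<lambda>v. a * w v + b * z v)) (lincomb a (V w) b (V z))) \<and>
     (\<exists>C. \<forall>w \<in> dual_Sigma T. L2_Sigma_norm T (V w) \<le> C * dual_norm T w) \<and>
     (\<forall>w \<in> L2_Sigma T. eq_AE T (V (L2_Sigma_inner T w)) (V_L2 L w))"

text \<open>
  The bounded linear extension is determined up to null sets, because $L^2(\Sigma)$ is dense in the dual space;
  the choice operator only selects representatives.
\<close>

definition V_op :: "real \<Rightarrow> real \<Rightarrow> (bdry \<Rightarrow> real) \<Rightarrow> bdry" where
  "V_op L T = (SOME V. V_extension L T V)"

definition time_slices :: "real \<Rightarrow> real \<Rightarrow> nat" where
  "time_slices L T = (LEAST m. T \<le> real m * L)"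

definition c_S :: "nat \<Rightarrow> real" where
  "c_S n = sin (pi / (2 * (2 * real n + 1)))"

end

theory Submission
  imports Defs
begin

text \<open>
  By the Riesz representation theorem every \<open>w\<close> in the dual space is the derivative of a unique
  \<open>f = (f\<^sub>0, f\<^sub>L)\<close> in $L^2(\Sigma)$, that is, \<open>w v = - \<langle>f, v'\<rangle>\<close>, and then the dual norm of \<open>w\<close> is
  the $L^2$ norm of \<open>f\<close>. The operator becomes
  $\mathsf{V}w = \frac12 (f_0(t) + f_L(t-L),\; f_0(t-L) + f_L(t))$ with \<open>f\<close> extended by 0, first for
  \<open>w\<close> in $L^2(\Sigma)$ and then, by density, for every bounded extension. For the lower bound let
  $\varphi_k = \sin(2k\theta)$ with $\theta = \pi/(2(2n+1))$, and let \<open>k\<close> be the index of the time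
  slice containing \<open>t\<close>. Pointwise
  $(f_0(t) + f_L(t-L))^2 \ge (1 - \varphi_{k-1}/\varphi_k) f_0(t)^2
    + (1 - \varphi_k/\varphi_{k-1}) f_L(t-L)^2$, and likewise with the components exchanged. After a
  shift of the second term the weights add up to
  $2 - (\varphi_{k-1} + \varphi_{k+1})/\varphi_k = 4 \sin^2\theta$; extending the shifted integral
  from $(0,T-L)$ to $(0,T)$ only adds a nonpositive term, as $\varphi_k \le \varphi_{k+1}$ for \<open>k \<le> n\<close>.
\<close>

section \<open>The space of square-integrable functions\<close>

text \<open>The condition q(T) = 0 fixes the constant of integration, so differentiation is, up to
  null sets, an isometry of H^1_{,0} onto L^2. Primitives start at 0 and test elements vanish at T,
  so integration by parts leaves no boundary term; this is why \<open>f\<close> is the primitive of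
  \<open>w\<close> when \<open>w\<close> lies in L^2. The delayed sum couples only the values at t,
  t + L, t + 2 L, ..., with the two components alternating along such a chain. It therefore acts on
  each chain as a bidiagonal matrix of size at most n with entries 1/2. Up to alternating signs,
  four times the Gram matrix (in size n) is the second difference matrix with \<phi>(0) = 0 and
  \<phi>(n+1) = \<phi>(n); its lowest eigenvalue is 4 sin^2 \<theta>, and the sines are its positive
  eigenvector. Building the weights from this eigenvector makes the estimate pointwise, so no
  decomposition into chains has to be formalised. The definitions add two burdens: the operator and
  the weak derivative are chosen by \<open>SOME\<close>, so existence and uniqueness up to null sets
  must come before any computation, and enough test functions, with derivatives of all orders, must
  be built by hand.\<close>

lemma L2_D: "f \<in> L2 T \<Longrightarrow> f \<in> borel_measurable (interval_measure T)"
  "f \<in> L2 T \<Longrightarrow> integrable (interval_measure T) (\<lambda>t. (f t)\<^sup>2)"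
  by (auto simp: L2_def)

lemma finite_measure_interval: "finite_measure (interval_measure T)"
  by (rule finite_measure_lebesgue_on) simp

lemma L2_mult_integrable:
  assumes "f \<in> L2 T" "g \<in> L2 T"
  shows "integrable (interval_measure T) (\<lambda>t. f t * g t)"
proof (rule Bochner_Integration.integrable_bound)
  note [measurable] = L2_D(1)[OF assms(1)] L2_D(1)[OF assms(2)]
  show "integrable (interval_measure T) (\<lambda>t. (f t)\<^sup>2 + (g t)\<^sup>2)"
    using assms L2_D(2) by auto
  show "(\<lambda>t. f t * g t) \<in> borel_measurable (interval_measure T)" by measurable
  have "\<bar>x * y\<bar> \<le> x\<^sup>2 + y\<^sup>2" for x y :: real
    using sum_squares_bound[of "\<bar>x\<bar>" "\<bar>y\<bar>"] by (auto simp: abs_mult intro: order_trans[rotated])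
  then show "AE t in interval_measure T. norm (f t * g t) \<le> norm ((f t)\<^sup>2 + (g t)\<^sup>2)"
    by simp
qed

lemma L2_integrable: "f \<in> L2 T \<Longrightarrow> integrable (interval_measure T) f"
  using finite_measure.square_integrable_imp_integrable[OF finite_measure_interval] L2_D by blast

lemma L2_lincomb:
  assumes "f \<in> L2 T" "g \<in> L2 T"
  shows "(\<lambda>t. a * f t + b * g t) \<in> L2 T"
proof -
  note [measurable] = L2_D(1)[OF assms(1)] L2_D(1)[OF assms(2)]
  have "integrable (interval_measure T) (\<lambda>t. a\<^sup>2 * (f t)\<^sup>2 + 2*a*b * (f t * g t) + b\<^sup>2 * (g t)\<^sup>2)"
    using assms L2_D(2) L2_mult_integrable by auto
  also have "(\<lambda>t. a\<^sup>2 * (f t)\<^sup>2 + 2*a*b * (f t * g t) + b\<^sup>2 * (g t)\<^sup>2) = (\<lambda>t. (a * f t + b * g t)\<^sup>2)"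
    by (auto simp: power2_eq_square algebra_simps)
  finally show ?thesis by (simp add: L2_def)
qed

lemma L2_zero [simp]: "(\<lambda>_. 0) \<in> L2 T"
  by (simp add: L2_def)

lemma L2_const [simp]: "(\<lambda>_. c) \<in> L2 T"
  using finite_measure.integrable_const[OF finite_measure_interval] by (simp add: L2_def)

lemma L2_scale: "f \<in> L2 T \<Longrightarrow> (\<lambda>t. a * f t) \<in> L2 T"
  using L2_lincomb[of f T f a 0] by simp

lemma L2_diff: "f \<in> L2 T \<Longrightarrow> g \<in> L2 T \<Longrightarrow> (\<lambda>t. f t - g t) \<in> L2 T"
  using L2_lincomb[of f T g 1 "-1"] by simp

lemma L2_bounded:
  assumes [measurable]: "f \<in> borel_measurable (interval_measure T)" 
    and "\<And>t. 0 < t \<Longrightarrow> t < T \<Longrightarrow> \<bar>f t\<bar> \<le> B"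
  shows "f \<in> L2 T"
proof -
  have "integrable (interval_measure T) (\<lambda>t. (f t)\<^sup>2)"
  proof (rule finite_measure.integrable_const_bound[OF finite_measure_interval])
    have "\<bar>f t\<bar>\<^sup>2 \<le> B\<^sup>2" if "0 < t" "t < T" for t
      using assms(2)[OF that] by (intro power_mono) auto
    then show "AE t in interval_measure T. norm ((f t)\<^sup>2) \<le> B\<^sup>2"
      by (intro AE_I2) auto
  qed measurable
  then show ?thesis by (simp add: L2_def)
qed

lemma L2_inner_commute: "L2_inner T f g = L2_inner T g f"
  by (simp add: L2_inner_def mult.commute)

lemma L2_inner_lincomb_left:
  assumes "f \<in> L2 T" "g \<in> L2 T" "h \<in> L2 T"
  shows "L2_inner T (\<lambda>t. a * f t + b * g t) h = a * L2_inner T f h + b * L2_inner T g h"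
  using L2_mult_integrable[OF assms(1,3)] L2_mult_integrable[OF assms(2,3)]
  by (simp add: L2_inner_def ring_distribs mult.assoc)

lemma L2_inner_lincomb_right:
  assumes "f \<in> L2 T" "g \<in> L2 T" "h \<in> L2 T"
  shows "L2_inner T h (\<lambda>t. a * f t + b * g t) = a * L2_inner T h f + b * L2_inner T h g"
  using L2_inner_lincomb_left[OF assms] by (simp add: L2_inner_commute)

lemma L2_inner_diff_left:
  assumes "f \<in> L2 T" "g \<in> L2 T" "h \<in> L2 T"
  shows "L2_inner T (\<lambda>t. f t - g t) h = L2_inner T f h - L2_inner T g h"
  using L2_inner_lincomb_left[OF assms, of 1 "-1"] by simp

lemma L2_inner_cong:
  assumes "AE t in interval_measure T. f t = f' t" "AE t in interval_measure T. g t = g' t"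
    and "f \<in> L2 T" "f' \<in> L2 T" "g \<in> L2 T" "g' \<in> L2 T"
  shows "L2_inner T f g = L2_inner T f' g'"
  unfolding L2_inner_def
proof (rule integral_cong_AE)
  note [measurable] = assms(3-6)[THEN L2_D(1)]
  show "(\<lambda>t. f t * g t) \<in> borel_measurable (interval_measure T)" 
    "(\<lambda>t. f' t * g' t) \<in> borel_measurable (interval_measure T)" by measurable
  show "AE t in interval_measure T. f t * g t = f' t * g' t"
    using assms(1,2) by eventually_elim simp
qed

lemma L2_inner_self: "L2_inner T f f = (LINT t|interval_measure T. (f t)\<^sup>2)"
  by (simp add: L2_inner_def power2_eq_square)

lemma L2_inner_self_nonneg [simp]: "0 \<le> L2_inner T f f"
  by (simp add: L2_inner_self)

lemma L2_norm_sq: "(L2_norm T f)\<^sup>2 = L2_inner T f f"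
  by (simp add: L2_norm_def)

lemma L2_norm_nonneg [simp]: "0 \<le> L2_norm T f"
  by (simp add: L2_norm_def)

lemma L2_norm_cong:
  assumes "AE t in interval_measure T. f t = f' t" "f \<in> L2 T" "f' \<in> L2 T"
  shows "L2_norm T f = L2_norm T f'"
  using L2_inner_cong[OF assms(1) assms(1)] assms by (simp add: L2_norm_def)

lemma L2_inner_self_lincomb:
  assumes "f \<in> L2 T" "g \<in> L2 T"
  shows "L2_inner T (\<lambda>t. a * f t + b * g t) (\<lambda>t. a * f t + b * g t)
     = a\<^sup>2 * L2_inner T f f + 2 * a * b * L2_inner T f g + b\<^sup>2 * L2_inner T g g"
  using assms L2_lincomb[OF assms]
  by (simp add: L2_inner_lincomb_left L2_inner_lincomb_right L2_inner_commute[of T g f]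
      power2_eq_square algebra_simps)

lemma L2_norm_scale:
  assumes "f \<in> L2 T" shows "L2_norm T (\<lambda>t. a * f t) = \<bar>a\<bar> * L2_norm T f"
  using L2_inner_self_lincomb[OF assms assms, of a 0] 
  by (simp add: L2_norm_def real_sqrt_mult)

lemma L2_inner_eq_0_iff:
  assumes "f \<in> L2 T"
  shows "L2_inner T f f = 0 \<longleftrightarrow> (AE t in interval_measure T. f t = 0)"
  unfolding L2_inner_self using L2_D(2)[OF assms] by (subst integral_nonneg_eq_0_iff_AE) auto

lemma L2_norm_eq_0_iff:
  assumes "f \<in> L2 T"
  shows "L2_norm T f = 0 \<longleftrightarrow> (AE t in interval_measure T. f t = 0)"
  using L2_inner_eq_0_iff[OF assms] by (simp add: L2_norm_def)

lemma L2_Cauchy_Schwarz: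
  assumes "f \<in> L2 T" "g \<in> L2 T"
  shows "\<bar>L2_inner T f g\<bar> \<le> L2_norm T f * L2_norm T g"
proof -
  let ?a = "L2_inner T f f" and ?b = "L2_inner T f g" and ?c = "L2_inner T g g"
  have 1: "0 \<le> ?a + 2 * s * ?b + s\<^sup>2 * ?c" for s
    using L2_inner_self_lincomb[OF assms, of 1 s]
      L2_inner_self_nonneg[of T "\<lambda>t. 1 * f t + s * g t"] by (simp del: L2_inner_self_nonneg)
  have "?b\<^sup>2 \<le> ?a * ?c"
  proof (cases "?c = 0")
    case True
    have "?b = 0"
    proof (rule ccontr)
      assume "?b \<noteq> 0"
      \<comment> \<open>At this \<open>s\<close> the polynomial, which is affine because
        \<open>?c = 0\<close>, takes the value -1.\<close>
      then show False using 1[of "-(?a+1)/(2 * ?b)"] True by (simp add: field_simps)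
    qed
    then show ?thesis using True by simp
  next
    case False
    then have "?c > 0" using L2_inner_self_nonneg[of T g] by linarith
    then show ?thesis using 1[of "- ?b / ?c"] by (simp add: field_simps power2_eq_square)
  qed
  then have "sqrt (?b\<^sup>2) \<le> sqrt (?a * ?c)" by (rule real_sqrt_le_mono)
  then show ?thesis by (simp add: L2_norm_def real_sqrt_mult)
qed

lemma L2_norm_triangle:
  assumes "f \<in> L2 T" "g \<in> L2 T"
  shows "L2_norm T (\<lambda>t. f t + g t) \<le> L2_norm T f + L2_norm T g"
proof (rule power2_le_imp_le)
  show "(L2_norm T (\<lambda>t. f t + g t))\<^sup>2 \<le> (L2_norm T f + L2_norm T g)\<^sup>2"
    using L2_inner_self_lincomb[OF assms, of 1 1] L2_Cauchy_Schwarz[OF assms]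
    by (simp add: L2_norm_sq power2_sum)
qed simp

lemma L2_norm_triangle_diff:
  assumes "f \<in> L2 T" "g \<in> L2 T" "h \<in> L2 T"
  shows "L2_norm T (\<lambda>t. f t - h t) \<le> L2_norm T (\<lambda>t. f t - g t) + L2_norm T (\<lambda>t. g t - h t)"
  using L2_norm_triangle[OF L2_diff[OF assms(1,2)] L2_diff[OF assms(2,3)]] by simp

lemma L2_norm_diff_commute: "L2_norm T (\<lambda>t. f t - g t) = L2_norm T (\<lambda>t. g t - f t)"
  by (simp add: L2_norm_def L2_inner_self power2_commute)

section \<open>Completeness of L^2 and Riesz representation\<close>

lemma L1_le_L2_norm:
  assumes "f \<in> L2 T" "T > 0"
  shows "(LINT t|interval_measure T. \<bar>f t\<bar>) \<le> L2_norm T f * sqrt T"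
proof -
  have a: "(\<lambda>t. \<bar>f t\<bar>) \<in> L2 T" using assms by (auto simp: L2_def)
  have "L2_norm T (\<lambda>t. \<bar>f t\<bar>) = L2_norm T f" by (simp add: L2_norm_def L2_inner_self)
  moreover have "L2_norm T (\<lambda>t. 1) = sqrt T"
    using assms(2) by (simp add: L2_norm_def L2_inner_self measure_restrict_space)
  ultimately show ?thesis
    using L2_Cauchy_Schwarz[OF a L2_const[of 1 T]] by (simp add: L2_inner_def)
qed

text \<open>Riesz-Fischer: a subsequence converges almost everywhere, and Fatou's lemma along it
  bounds the distance of every late term to the pointwise limit. So the whole sequence converges,
  not just the subsequence.\<close>

theorem L2_complete:
  assumes f: "\<And>i. f i \<in> L2 T" and "T > 0"
    and Cauchy: "\<And>e. e > 0 \<Longrightarrow> \<exists>N. \<forall>i\<ge>N. \<forall>j\<ge>N. L2_norm T (\<lambda>t. f i t - f j t) < e"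
  shows "\<exists>p \<in> L2 T. (\<lambda>i. L2_norm T (\<lambda>t. f i t - p t)) \<longlonglongrightarrow> 0"
proof -
  let ?M = "interval_measure T"
  note [measurable] = L2_D(1)[OF f]
  have L1: "\<exists>N. \<forall>i\<ge>N. \<forall>j\<ge>N. LINT t|?M. norm (f i t - f j t) < e" if "e > 0" for e
  proof -
    \<comment> \<open>The subsequence is extracted from the Cauchy property in L^1. On a bounded
      interval the L^1 norm is at most sqrt T times the L^2 norm, whence this tolerance.\<close>
    have "e / sqrt T > 0" using that \<open>T > 0\<close> by simp
    from Cauchy[OF this] obtain N where N: "\<forall>i\<ge>N. \<forall>j\<ge>N. L2_norm T (\<lambda>t. f i t - f j t) < e / sqrt T" 
      by blast
    have "(LINT t|?M. norm (f i t - f j t)) < e" if "i \<ge> N" "j \<ge> N" for i j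
    proof -
      have "L2_norm T (\<lambda>t. f i t - f j t) * sqrt T < e" 
        using N that \<open>T > 0\<close> by (simp add: field_simps)
      then show ?thesis using L1_le_L2_norm[OF L2_diff[OF f[of i] f[of j]] \<open>T > 0\<close>] by simp
    qed
    then show ?thesis by blast
  qed
  obtain r where r: "strict_mono r" and ae: "AE t in ?M. Cauchy (\<lambda>i. f (r i) t)"
    using cauchy_L1_AE_cauchy_subseq[of ?M f] L2_integrable[OF f] L1 by auto
  define p where "p t = lim (\<lambda>i. f (r i) t)" for t
  have pm [measurable]: "p \<in> borel_measurable ?M" unfolding p_def by measurable
  have conv: "AE t in ?M. (\<lambda>i. f (r i) t) \<longlonglongrightarrow> p t"
    using ae by eventually_elim (simp add: p_def Cauchy_convergent_iff convergent_LIMSEQ_iff)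
  \<comment> \<open>Stated with the nonnegative integral, since square integrability of
    \<open>f i - p\<close> is not known yet and is itself deduced from this estimate.\<close>
  have est: "(\<integral>\<^sup>+t. ennreal ((f i t - p t)\<^sup>2) \<partial>?M) \<le> ennreal (e\<^sup>2)"
    if N: "\<forall>i\<ge>N. \<forall>j\<ge>N. L2_norm T (\<lambda>t. f i t - f j t) < e" "i \<ge> N" for e N i
  proof -
    have 1: "(\<integral>\<^sup>+t. ennreal ((f i t - f (r j) t)\<^sup>2) \<partial>?M) \<le> ennreal (e\<^sup>2)" if "j \<ge> N" for j
    proof -
      have "r j \<ge> N" using that seq_suble[OF r] order_trans by blast
      then have "L2_norm T (\<lambda>t. f i t - f (r j) t) \<le> e" using N by (simp add: less_imp_le)
      then have "(L2_norm T (\<lambda>t. f i t - f (r j) t))\<^sup>2 \<le> e\<^sup>2" by (intro power_mono) auto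
      moreover have "(\<integral>\<^sup>+t. ennreal ((f i t - f (r j) t)\<^sup>2) \<partial>?M) = ennreal ((L2_norm T (\<lambda>t. f i t - f (r j) t))\<^sup>2)"
        unfolding L2_norm_sq L2_inner_self
        by (rule nn_integral_eq_integral) (use L2_D(2)[OF L2_diff[OF f f]] in auto)
      ultimately show ?thesis by (simp add: ennreal_leI)
    qed
    have "(\<integral>\<^sup>+t. ennreal ((f i t - p t)\<^sup>2) \<partial>?M) 
        = (\<integral>\<^sup>+t. liminf (\<lambda>j. ennreal ((f i t - f (r j) t)\<^sup>2)) \<partial>?M)"
    proof (rule nn_integral_cong_AE)
      show "AE t in ?M. ennreal ((f i t - p t)\<^sup>2) = liminf (\<lambda>j. ennreal ((f i t - f (r j) t)\<^sup>2))"
        using conv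
      proof eventually_elim
        case (elim t)
        have "(\<lambda>j. ennreal ((f i t - f (r j) t)\<^sup>2)) \<longlonglongrightarrow> ennreal ((f i t - p t)\<^sup>2)"
          by (intro tendsto_intros elim)
        then show ?case by (rule lim_imp_Liminf[OF sequentially_bot, symmetric])
      qed
    qed
    also have "\<dots> \<le> liminf (\<lambda>j. \<integral>\<^sup>+t. ennreal ((f i t - f (r j) t)\<^sup>2) \<partial>?M)"
      by (rule nn_integral_liminf) measurable
    also have "\<dots> \<le> liminf (\<lambda>j. ennreal (e\<^sup>2))"
      by (rule Liminf_mono) (use 1 in \<open>auto simp: eventually_sequentially\<close>)
    finally show ?thesis by (simp add: Liminf_const)
  qed
  have pd: "(\<lambda>t. f i t - p t) \<in> L2 T"
    if N: "\<forall>i\<ge>N. \<forall>j\<ge>N. L2_norm T (\<lambda>t. f i t - f j t) < e" "i \<ge> N" for e N i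
  proof -
    have "integrable ?M (\<lambda>t. (f i t - p t)\<^sup>2)"
      by (rule integrableI_nonneg) (use est[OF that] in \<open>auto simp: le_less_trans\<close>)
    then show ?thesis by (simp add: L2_def)
  qed
  obtain N1 where N1: "\<forall>i\<ge>N1. \<forall>j\<ge>N1. L2_norm T (\<lambda>t. f i t - f j t) < 1" using Cauchy[of 1] by auto
  \<comment> \<open>\<open>p\<close> is recovered as \<open>f N1 - (f N1 - p)\<close>, both terms
    being square integrable.\<close>
  have p: "p \<in> L2 T" using L2_diff[OF f[of N1] pd[OF N1 order_refl]] by simp
  have "(\<lambda>i. L2_norm T (\<lambda>t. f i t - p t)) \<longlonglongrightarrow> 0"
  proof (rule LIMSEQ_I)
    fix e :: real assume "e > 0"
    then obtain N where N: "\<forall>i\<ge>N. \<forall>j\<ge>N. L2_norm T (\<lambda>t. f i t - f j t) < e/2" using Cauchy[of "e/2"] by auto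
    have "norm (L2_norm T (\<lambda>t. f i t - p t) - 0) < e" if "i \<ge> N" for i
    proof -
      have "ennreal ((L2_norm T (\<lambda>t. f i t - p t))\<^sup>2) = (\<integral>\<^sup>+t. ennreal ((f i t - p t)\<^sup>2) \<partial>?M)"
        unfolding L2_norm_sq L2_inner_self
        by (rule nn_integral_eq_integral[symmetric]) (use L2_D(2)[OF L2_diff[OF f p]] in auto)
      also have "\<dots> \<le> ennreal ((e/2)\<^sup>2)" by (rule est[OF N that])
      finally have "(L2_norm T (\<lambda>t. f i t - p t))\<^sup>2 \<le> (e/2)\<^sup>2" by (subst (asm) ennreal_le_iff) auto
      then have "L2_norm T (\<lambda>t. f i t - p t) \<le> e/2" using \<open>e > 0\<close> by (simp add: power2_le_iff_abs_le)
      then show ?thesis using \<open>e > 0\<close> by simp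
    qed
    then show "\<exists>N. \<forall>i\<ge>N. norm (L2_norm T (\<lambda>t. f i t - p t) - 0) < e" by blast
  qed
  then show ?thesis using p by blast
qed

lemma L2_inner_tendsto:
  assumes "\<And>i. f i \<in> L2 T" "p \<in> L2 T" "g \<in> L2 T" "(\<lambda>i. L2_norm T (\<lambda>t. f i t - p t)) \<longlonglongrightarrow> 0"
  shows "(\<lambda>i. L2_inner T (f i) g) \<longlonglongrightarrow> L2_inner T p g"
proof (rule LIM_zero_cancel, rule Lim_null_comparison)
  show "(\<lambda>i. L2_norm T (\<lambda>t. f i t - p t) * L2_norm T g) \<longlonglongrightarrow> 0"
    by (rule tendsto_mult_left_zero[OF assms(4)])
  show "\<forall>\<^sub>F i in sequentially. norm (L2_inner T (f i) g - L2_inner T p g) \<le> L2_norm T (\<lambda>t. f i t - p t) * L2_norm T g"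
    using L2_Cauchy_Schwarz[OF L2_diff[OF assms(1,2)] assms(3)] 
    by (simp add: L2_inner_diff_left assms)
qed

text \<open>
  Minimising \<open>\<parallel>f\<parallel>\<^sup>2 - 2 \<Lambda> f\<close> over a subspace that need not be closed: for \<open>D = L2 T\<close> this is the Riesz
  representation theorem, while for \<open>\<Lambda> = L2_inner T f\<close> it is the orthogonal projection of \<open>f\<close> onto
  the closure of \<open>D\<close>, which serves to show that \<open>D\<close> is dense.
\<close>

lemma L2_Riesz:
  assumes D: "D \<subseteq> L2 T" "D \<noteq> {}" "\<And>a b f g. f \<in> D \<Longrightarrow> g \<in> D \<Longrightarrow> (\<lambda>t. a * f t + b * g t) \<in> D"
    and lin: "\<And>a b f g. f \<in> D \<Longrightarrow> g \<in> D \<Longrightarrow> \<Lambda> (\<lambda>t. a * f t + b * g t) = a * \<Lambda> f + b * \<Lambda> g"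
    and bdd: "\<And>f. f \<in> D \<Longrightarrow> \<bar>\<Lambda> f\<bar> \<le> C * L2_norm T f"
    and "T > 0"
  shows "\<exists>p d. p \<in> L2 T \<and> (\<forall>i::nat. d i \<in> D) \<and> (\<lambda>i. L2_norm T (\<lambda>t. d i t - p t)) \<longlonglongrightarrow> 0 \<and>
     (\<forall>f \<in> D. L2_inner T p f = \<Lambda> f)"
proof -
  define J where "J f = L2_inner T f f - 2 * \<Lambda> f" for f
  have bd: "- C\<^sup>2 \<le> J f" if "f \<in> D" for f
  proof -
    have "0 \<le> (L2_norm T f - C)\<^sup>2" by simp
    then show ?thesis using bdd[OF that] by (simp add: J_def power2_diff L2_norm_sq[symmetric] mult.commute)
  qed
  define m where "m = Inf (J ` D)"
  have bb: "bdd_below (J ` D)" using bd by (auto intro!: bdd_belowI[of _ "- C\<^sup>2"])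
  have m: "m \<le> J f" if "f \<in> D" for f unfolding m_def using bb that by (auto intro: cInf_lower)
  have "\<exists>f \<in> D. J f < m + 1 / real (Suc i)" for i
    using cInf_lessD[of "J ` D" "m + 1 / real (Suc i)"] D(2) by (auto simp: m_def)
  then obtain d where d: "\<And>i. d i \<in> D" "\<And>i. J (d i) < m + 1 / real (Suc i)" by metis
  have dL: "d i \<in> L2 T" for i using d D by auto
  have J: "J (\<lambda>t. a * f t + b * g t) = a\<^sup>2 * L2_inner T f f + 2*a*b * L2_inner T f g + b\<^sup>2 * L2_inner T g g
     - 2*a*\<Lambda> f - 2 *b*\<Lambda> g" if "f \<in> D" "g \<in> D" for a b f g
    using that D(1) by (simp add: J_def lin L2_inner_self_lincomb subset_iff)
  \<comment> \<open>Parallelogram law: the left side equals 2 J(d i) + 2 J(d j) - 4 J(midpoint), and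
    the midpoint stays in \<open>D\<close>, so its value is at least \<open>m\<close>. This makes
    the minimising sequence Cauchy.\<close>
  have par: "L2_inner T (\<lambda>t. d i t - d j t) (\<lambda>t. d i t - d j t) \<le> 2 / real (Suc i) + 2 / real (Suc j)" for i j
  proof -
    have "m \<le> J (\<lambda>t. 1/2 * d i t + 1/2 * d j t)" by (intro m D d)
    moreover have "J (\<lambda>t. 1/2 * d i t + 1/2 * d j t) = 1/4 * L2_inner T (d i) (d i) + 1/2 * L2_inner T (d i) (d j)
      + 1/4 * L2_inner T (d j) (d j) - \<Lambda> (d i) - \<Lambda> (d j)"
      by (subst J) (use d in \<open>auto simp: power2_eq_square\<close>)
    moreover have "L2_inner T (\<lambda>t. d i t - d j t) (\<lambda>t. d i t - d j t) 
       = L2_inner T (d i) (d i) - 2 * L2_inner T (d i) (d j) + L2_inner T (d j) (d j)"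
      using L2_inner_self_lincomb[OF dL[of i] dL[of j], of 1 "-1"] by simp
    ultimately show ?thesis using d(2)[of i] d(2)[of j] by (simp add: J_def)
  qed
  have "\<exists>N. \<forall>i\<ge>N. \<forall>j\<ge>N. L2_norm T (\<lambda>t. d i t - d j t) < e" if "e > 0" for e
  proof -
    have "e\<^sup>2 / 4 > 0" using that by simp
    then obtain N where N: "1 / real (Suc N) < e\<^sup>2 / 4" using nat_approx_posE by blast
    have "L2_norm T (\<lambda>t. d i t - d j t) < e" if "i \<ge> N" "j \<ge> N" for i j
    proof -
      have "1 / real (Suc i) \<le> 1 / real (Suc N)" "1 / real (Suc j) \<le> 1 / real (Suc N)"
        using that by (auto intro!: divide_left_mono)
      then have "(L2_norm T (\<lambda>t. d i t - d j t))\<^sup>2 < e\<^sup>2" using par[of i j] N unfolding L2_norm_sq by simp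
      then show ?thesis using \<open>e > 0\<close> by (simp add: power_less_imp_less_base)
    qed
    then show ?thesis by blast
  qed
  from L2_complete[OF dL \<open>T > 0\<close> this] obtain p where p: "p \<in> L2 T"
    and lim: "(\<lambda>i. L2_norm T (\<lambda>t. d i t - p t)) \<longlonglongrightarrow> 0" by blast
  have "L2_inner T p f = \<Lambda> f" if f: "f \<in> D" for f
  proof -
    have fL: "f \<in> L2 T" using f D by auto
    let ?a = "L2_inner T p f - \<Lambda> f" and ?b = "L2_inner T f f"
    \<comment> \<open>The limit \<open>p\<close> may lie outside \<open>D\<close>, where nothing is
      known about \<Lambda>. The variation in direction \<open>f\<close> is therefore taken at
      \<open>d i\<close>, which is minimal up to 1/(i+1), and only the resulting inequality is
      passed to the limit.\<close>
    have ge: "0 \<le> 2 * s * ?a + s\<^sup>2 * ?b" for s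
    proof (rule LIMSEQ_le)
      have "2 * s * (L2_inner T (d i) f - \<Lambda> f) + s\<^sup>2 * ?b = J (\<lambda>t. 1 * d i t + s * f t) - J (d i)" for i
        by (subst J[OF d(1) f]) (simp add: J_def algebra_simps)
      moreover have "m \<le> J (\<lambda>t. 1 * d i t + s * f t)" for i by (intro m D d f)
      ultimately have "- (1 / real (Suc i)) \<le> 2 * s * (L2_inner T (d i) f - \<Lambda> f) + s\<^sup>2 * ?b" for i
        using d(2)[of i] by (smt (verit))
      then show "\<exists>N. \<forall>i\<ge>N. - (1 / real (Suc i)) \<le> 2 * s * (L2_inner T (d i) f - \<Lambda> f) + s\<^sup>2 * ?b" by blast
      show "(\<lambda>i. - (1 / real (Suc i))) \<longlonglongrightarrow> 0"
        using LIMSEQ_inverse_real_of_nat_add_minus[of 0] by (simp add: inverse_eq_divide)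
      show "(\<lambda>i. 2 * s * (L2_inner T (d i) f - \<Lambda> f) + s\<^sup>2 * ?b) \<longlonglongrightarrow> 2 * s * ?a + s\<^sup>2 * ?b"
        by (intro tendsto_intros L2_inner_tendsto dL p fL lim)
    qed
    show ?thesis
    proof (rule ccontr)
      assume "L2_inner T p f \<noteq> \<Lambda> f"
      moreover have "x = 0" if "0 \<le> b" "\<And>s. 0 \<le> 2 * s * x + s\<^sup>2 * b" for x b :: real
      proof (rule ccontr)
        assume "x \<noteq> 0"
        \<comment> \<open>Dividing by b + 1 instead of b also covers b = 0.\<close>
        have "0 \<le> 2 * (- x / (b+1)) * x + (- x / (b+1))\<^sup>2 * b" by (rule that)
        also have "\<dots> = (x / (b + 1))\<^sup>2 * (- 2 * (b + 1) + b)"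
          using that(1) by (simp add: power2_eq_square divide_simps) (simp add: algebra_simps)
        also have "\<dots> < 0"
          using that(1) \<open>x \<noteq> 0\<close> by (intro mult_pos_neg) auto
        finally show False by simp
      qed
      ultimately show False using ge L2_inner_self_nonneg[of T f] by fastforce
    qed
  qed
  then show ?thesis using p d(1) lim by blast
qed

section \<open>Smooth bump functions\<close>

lemma poly_times_exp_tendsto_0:
  assumes "c > (0::real)"
  shows "((\<lambda>x. poly p x * exp (- c * x)) \<longlongrightarrow> 0) at_top"
proof -
  have 1: "((\<lambda>x. x ^ n * exp (- c * x)) \<longlongrightarrow> 0) at_top" for n
  proof -
    have "filterlim (\<lambda>x. c * x) at_top at_top"
      using assms by (intro filterlim_tendsto_pos_mult_at_top[OF tendsto_const] filterlim_ident)
    from filterlim_compose[OF tendsto_power_div_exp_0[of n] this]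
    have "((\<lambda>x. inverse (c ^ n) * ((c * x) ^ n / exp (c * x))) \<longlongrightarrow> inverse (c ^ n) * 0) at_top"
      by (intro tendsto_intros)
    also have "(\<lambda>x. inverse (c ^ n) * ((c * x) ^ n / exp (c * x))) = (\<lambda>x. x ^ n * exp (- c * x))"
      using assms by (auto simp: fun_eq_iff power_mult_distrib exp_minus field_simps)
    finally show ?thesis by simp
  qed
  have "((\<lambda>x. \<Sum>i\<le>degree p. coeff p i * (x ^ i * exp (- c * x))) \<longlongrightarrow> (\<Sum>i\<le>degree p. coeff p i * 0)) at_top"
    by (intro tendsto_sum tendsto_mult_left 1)
  also have "(\<lambda>x. \<Sum>i\<le>degree p. coeff p i * (x ^ i * exp (- c * x))) = (\<lambda>x. poly p x * exp (- c * x))"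
    by (simp add: poly_altdef sum_distrib_right mult.assoc)
  finally show ?thesis by simp
qed

text \<open>For t > 0 differentiation replaces p by x^2 (c p - p'), again evaluated at 1/t, so the
  shape is preserved. At 0 the exponential beats every polynomial in 1/t.\<close>

lemma flat_has_derivative:
  fixes p :: "real poly"
  assumes "c > 0"
  shows "((\<lambda>t. if t > 0 then poly p (1/t) * exp (- c / t) else 0) has_field_derivative
     (if t > 0 then poly ([:0,0,1:] * (smult c p - pderiv p)) (1/t) * exp (- c / t) else 0)) (at t)"
    (is "(?f has_field_derivative _) _")
proof -
  consider "t > 0" | "t < 0" | "t = 0" by linarith
  then show ?thesis
  proof cases
    case 1
    have "((\<lambda>t. poly p (1/t) * exp (- c / t)) has_field_derivative 
       poly ([:0,0,1:] * (smult c p - pderiv p)) (1/t) * exp (- c / t)) (at t)"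
      using 1 by (auto intro!: derivative_eq_intros DERIV_chain2[OF poly_DERIV] 
          simp: field_simps power2_eq_square)
    then have "(?f has_field_derivative poly ([:0,0,1:] * (smult c p - pderiv p)) (1/t) * exp (- c / t)) (at t)"
      by (rule has_field_derivative_transform_within_open[where S="{0<..}"]) (use 1 in auto)
    then show ?thesis using 1 by simp
  next
    case 2
    have "((\<lambda>_. 0) has_field_derivative 0) (at t)" by simp
    then have "(?f has_field_derivative 0) (at t)"
      by (rule has_field_derivative_transform_within_open[where S="{..<0}"]) (use 2 in auto)
    then show ?thesis using 2 by simp
  next
    case 3
    \<comment> \<open>Under x = 1/h this is the right difference quotient at 0; the factor x is the
      division by h.\<close>
    have "((\<lambda>x. poly ([:0,1:] * p) x * exp (- c * x)) \<longlongrightarrow> 0) at_top"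
      by (rule poly_times_exp_tendsto_0[OF assms])
    from filterlim_compose[OF this filterlim_inverse_at_top_right]
    have "((\<lambda>h. (?f (0 + h) - ?f 0) / h) \<longlongrightarrow> 0) (at_right 0)"
      by (rule Lim_transform_eventually) 
        (auto simp: field_simps intro: eventually_mono[OF eventually_at_right_less])
    moreover have "((\<lambda>h. (?f (0 + h) - ?f 0) / h) \<longlongrightarrow> 0) (at_left 0)"
      by (rule Lim_transform_eventually[OF tendsto_const]) 
        (auto simp: eventually_at_filter)
    ultimately have "((\<lambda>h. (?f (0 + h) - ?f 0) / h) \<longlongrightarrow> 0) (at 0)"
      by (rule filterlim_split_at[rotated])
    then show ?thesis using 3 by (simp add: DERIV_def)
  qed
qed

text \<open>
  Closing up inductively makes the class stable under differentiation, so a single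
  derivative computation yields derivatives of all orders.
\<close>

inductive elem_smooth :: "(real \<Rightarrow> real) \<Rightarrow> bool" where
  flat: "c > 0 \<Longrightarrow> elem_smooth (\<lambda>t. if t > 0 then poly p (1/t) * exp (- c / t) else 0)"
| const: "elem_smooth (\<lambda>_. c)"
| add: "elem_smooth f \<Longrightarrow> elem_smooth g \<Longrightarrow> elem_smooth (\<lambda>t. f t + g t)"
| mult: "elem_smooth f \<Longrightarrow> elem_smooth g \<Longrightarrow> elem_smooth (\<lambda>t. f t * g t)"
| affine: "elem_smooth f \<Longrightarrow> elem_smooth (\<lambda>t. f (a + b * t))"
| antideriv: "elem_smooth f \<Longrightarrow> (\<And>t. (F has_field_derivative f t) (at t)) \<Longrightarrow> elem_smooth F"

lemma elem_smooth_deriv: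
  "elem_smooth f \<Longrightarrow> \<exists>g. elem_smooth g \<and> (\<forall>t. (f has_field_derivative g t) (at t))"
proof (induction rule: elem_smooth.induct)
  case (flat c p)
  then show ?case
    using flat_has_derivative[OF flat] elem_smooth.flat[OF flat] by blast
next
  case (const c)
  then show ?case by (intro exI[of _ "\<lambda>_. 0"]) (auto intro: elem_smooth.const)
next
  case (add f g)
  then obtain f' g' where "elem_smooth f'" "elem_smooth g'" 
    "\<And>t. (f has_field_derivative f' t) (at t)" "\<And>t. (g has_field_derivative g' t) (at t)" by blast
  then show ?case
    by (intro exI[of _ "\<lambda>t. f' t + g' t"]) (auto intro: elem_smooth.add DERIV_add)
next
  case (mult f g)
  then obtain f' g' where "elem_smooth f'" "elem_smooth g'" 
    "\<And>t. (f has_field_derivative f' t) (at t)" "\<And>t. (g has_field_derivative g' t) (at t)" by blast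
  with mult show ?case
    by (intro exI[of _ "\<lambda>t. f' t * g t + g' t * f t"]) (auto intro!: elem_smooth.add elem_smooth.mult DERIV_mult)
next
  case (affine f a b)
  then obtain f' where f': "elem_smooth f'" "\<And>t. (f has_field_derivative f' t) (at t)" by blast
  show ?case
    by (intro exI[of _ "\<lambda>t. f' (a + b * t) * b"])
      (auto intro!: elem_smooth.mult elem_smooth.const elem_smooth.affine f' DERIV_chain2[OF f'(2)] derivative_eq_intros)
next
  case (antideriv f F)
  then show ?case by blast
qed

lemma elem_smooth_higher_deriv:
  assumes "elem_smooth f" shows "elem_smooth ((deriv ^^ k) f)"
proof (induction k)
  case (Suc k)
  then obtain g where g: "elem_smooth g" "\<And>t. ((deriv ^^ k) f has_field_derivative g t) (at t)"
    using elem_smooth_deriv by blast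
  then have "deriv ((deriv ^^ k) f) = g" by (auto intro: DERIV_imp_deriv)
  then show ?case using g by simp
qed (use assms in simp)

lemma elem_smooth_differentiable: "elem_smooth f \<Longrightarrow> f differentiable (at t)"
  using elem_smooth_deriv real_differentiable_def by blast

lemma elem_smooth_continuous: "elem_smooth f \<Longrightarrow> continuous_on S f"
  by (meson continuous_at_imp_continuous_on differentiable_imp_continuous_within elem_smooth_differentiable)

text \<open>A subclass of the test functions whose smoothness is established structurally and which
  contains the antiderivatives of its members of mean zero. The bounds need not be ordered, so the
  interval may be empty.\<close>

definition bump :: "real \<Rightarrow> (real \<Rightarrow> real) \<Rightarrow> bool" where
  "bump T \<phi> \<longleftrightarrow> elem_smooth \<phi> \<and> (\<exists>\<alpha> \<beta>. 0 < \<alpha> \<and> \<beta> < T \<and> (\<forall>t. t \<notin> {\<alpha>..\<beta>} \<longrightarrow> \<phi> t = 0))"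

lemma bump_test_function:
  assumes "bump T \<phi>" shows "\<phi> \<in> test_functions T"
proof -
  obtain \<alpha> \<beta> where "0 < \<alpha>" "\<beta> < T" "\<forall>t. t \<notin> {\<alpha>..\<beta>} \<longrightarrow> \<phi> t = 0" "elem_smooth \<phi>" 
    using assms by (auto simp: bump_def)
  then show ?thesis
    by (auto simp: test_functions_def intro!: elem_smooth_differentiable elem_smooth_higher_deriv exI[of _ "{\<alpha>..\<beta>}"])
qed

lemma bump_lincomb:
  assumes "bump T \<phi>" "bump T \<psi>" shows "bump T (\<lambda>t. a * \<phi> t + b * \<psi> t)"
proof -
  obtain \<alpha> \<beta> \<alpha>' \<beta>' where 1: "0 < \<alpha>" "\<beta> < T" "\<forall>t. t \<notin> {\<alpha>..\<beta>} \<longrightarrow> \<phi> t = 0" "elem_smooth \<phi>" 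
    "0 < \<alpha>'" "\<beta>' < T" "\<forall>t. t \<notin> {\<alpha>'..\<beta>'} \<longrightarrow> \<psi> t = 0" "elem_smooth \<psi>" 
    using assms by (auto simp: bump_def)
  have "elem_smooth (\<lambda>t. a * \<phi> t + b * \<psi> t)"
    using 1 by (intro elem_smooth.add elem_smooth.mult elem_smooth.const)
  moreover have "0 < min \<alpha> \<alpha>' \<and> max \<beta> \<beta>' < T \<and> (\<forall>t. t \<notin> {min \<alpha> \<alpha>'..max \<beta> \<beta>'} \<longrightarrow> a * \<phi> t + b * \<psi> t = 0)"
    using 1 by (auto simp: min_le_iff_disj le_max_iff_disj)
  ultimately show ?thesis unfolding bump_def by blast
qed

section \<open>Approximation by bump functions and the fundamental lemma of the calculus of
  variations\<close>

lemma continuous_measurable_interval: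
  "continuous_on {0..T} f \<Longrightarrow> f \<in> borel_measurable (interval_measure T)"
  by (rule continuous_imp_measurable_on_sets_lebesgue) 
    (auto intro: continuous_on_subset)

lemma continuous_L2:
  assumes "continuous_on {0..T} f" shows "f \<in> L2 T"
proof -
  have "compact (f ` {0..T})" using assms by (intro compact_continuous_image) auto
  then obtain B where "\<And>t. t \<in> {0..T} \<Longrightarrow> \<bar>f t\<bar> \<le> B"
    using compact_imp_bounded[of "f ` {0..T}"] unfolding bounded_iff by force
  then show ?thesis by (intro L2_bounded[OF continuous_measurable_interval[OF assms], of B]) auto
qed

lemma bump_L2: "bump T \<phi> \<Longrightarrow> \<phi> \<in> L2 T"
  by (auto simp: bump_def intro: continuous_L2 elem_smooth_continuous)

text \<open>The bump is a product of two flat functions, one rising from the left endpoint and one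
  reflected at the right endpoint. Both endpoints move inwards by \<delta>, which keeps the support
  inside the open interval even when a = 0 or b = T.\<close>

lemma bump_approximates_indicator:
  assumes "0 \<le> a" "b \<le> T"
  obtains \<psi> where "\<And>j::nat. bump T (\<psi> j)" "\<And>j t. \<bar>\<psi> j t\<bar> \<le> 1" 
    "\<And>t. (\<lambda>j. \<psi> j t) \<longlonglongrightarrow> indicator {a<..<b} t"
proof -
  \<comment> \<open>\<open>exp (- \<delta> / s)\<close> stays in \<open>{0..1}\<close> and tends to 1 as \<open>\<delta>\<close> tends to 0, for every \<open>s > 0\<close>.\<close>
  define e :: "real \<Rightarrow> real \<Rightarrow> real" where "e c s = (if s > 0 then poly 1 (1/s) * exp (- c / s) else 0)" for c s
  define \<delta> where "\<delta> j = 1 / real (Suc j)" for j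
  have \<delta>: "\<delta> j > 0" for j by (simp add: \<delta>_def)
  have \<delta>0: "\<delta> \<longlonglongrightarrow> 0" 
    using LIMSEQ_inverse_real_of_nat by (simp add: \<delta>_def[abs_def] inverse_eq_divide)
  define \<psi> where "\<psi> j t = e (\<delta> j) (-(a + \<delta> j) + 1 * t) * e (\<delta> j) ((b - \<delta> j) + (-1) * t)" for j t
  have "elem_smooth (e c)" if "c > 0" for c
    unfolding e_def[abs_def] using that by (rule elem_smooth.flat)
  then have "elem_smooth (\<psi> j)" for j
    unfolding \<psi>_def[abs_def] using \<delta> by (intro elem_smooth.mult elem_smooth.affine) auto
  moreover have "0 < a + \<delta> j \<and> b - \<delta> j < T \<and> (\<forall>t. t \<notin> {a + \<delta> j..b - \<delta> j} \<longrightarrow> \<psi> j t = 0)" for j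
    using \<delta>[of j] assms by (auto simp: \<psi>_def e_def)
  ultimately have "bump T (\<psi> j)" for j unfolding bump_def by blast
  moreover have "\<bar>\<psi> j t\<bar> \<le> 1" for j t
  proof -
    have "0 \<le> e (\<delta> j) s" "e (\<delta> j) s \<le> 1" for s using \<delta>[of j] by (auto simp: e_def)
    then show ?thesis by (auto simp: \<psi>_def abs_mult intro!: mult_le_one)
  qed
  moreover have "(\<lambda>j. \<psi> j t) \<longlonglongrightarrow> indicator {a<..<b} t" for t
  proof (cases "t \<in> {a<..<b}")
    case True
    have e: "(\<lambda>j. e (\<delta> j) (s j)) \<longlonglongrightarrow> 1" if "s \<longlonglongrightarrow> s0" "s0 > 0" for s s0
    proof (rule Lim_transform_eventually)
      have "(\<lambda>j. exp (- \<delta> j / s j)) \<longlonglongrightarrow> exp (- 0 / s0)"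
        using that by (intro tendsto_intros \<delta>0) auto
      then show "(\<lambda>j. exp (- \<delta> j / s j)) \<longlonglongrightarrow> 1" by simp
      have "\<forall>\<^sub>F j in sequentially. s j > 0" using that by (rule order_tendstoD)
      then show "\<forall>\<^sub>F j in sequentially. exp (- \<delta> j / s j) = e (\<delta> j) (s j)"
        by eventually_elim (simp add: e_def)
    qed
    have "(\<lambda>j. \<psi> j t) \<longlonglongrightarrow> 1 * 1" unfolding \<psi>_def
    proof (intro tendsto_mult e)
      show "(\<lambda>j. - (a + \<delta> j) + 1 * t) \<longlonglongrightarrow> - (a + 0) + 1 * t" by (intro tendsto_intros \<delta>0)
      show "(\<lambda>j. b - \<delta> j + (-1) * t) \<longlonglongrightarrow> b - 0 + (-1) * t" by (intro tendsto_intros \<delta>0)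
    qed (use True in auto)
    then show ?thesis using True by simp
  next
    case False
    then have "\<psi> j t = 0" for j using \<delta>[of j] by (auto simp: \<psi>_def e_def)
    then show ?thesis using False by simp
  qed
  ultimately show ?thesis by (rule that)
qed

text \<open>Dynkin's argument: open intervals form a generator of the Borel sets that is closed
  under intersection, and the sets with vanishing integral are closed under complements and
  countable disjoint unions.\<close>

lemma set_integral_zero_imp_AE_zero:
  fixes g :: "real \<Rightarrow> real"
  assumes g: "integrable (interval_measure T) g"
    and 0: "\<And>a b. 0 \<le> a \<Longrightarrow> b \<le> T \<Longrightarrow> (LINT t|interval_measure T. indicator {a<..<b} t * g t) = 0"
  shows "AE t in interval_measure T. g t = 0"
proof -
  let ?M = "interval_measure T"
  interpret finite_measure ?M by (rule finite_measure_interval)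
  have iM: "A \<inter> {0<..<T} \<in> sets ?M" if "A \<in> sets lebesgue" for A
    using that by (auto simp: sets_restrict_space_iff)
  have intg: "integrable ?M (\<lambda>t. indicator A t * g t)" if "A \<in> sets lebesgue" for A
  proof -
    have "integrable ?M (\<lambda>t. indicator (A \<inter> {0<..<T}) t *\<^sub>R g t)"
      by (rule integrable_mult_indicator[OF iM[OF that] g])
    then show ?thesis by (rule Bochner_Integration.integrable_cong[THEN iffD1, rotated -1]) (auto simp: indicator_def)
  qed
  have gen: "sigma_sets UNIV (range (\<lambda>(a, b). {a<..<b::real})) = sets borel"
    by (simp add: borel_eq_box box_real)
  have bint: "(LINT t|?M. indicator A t * g t) = 0" if "A \<in> sets borel" for A
  proof -
    let ?G = "range (\<lambda>(a, b). {a<..<b::real})"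
    have "Int_stable ?G" by (auto simp: Int_stable_def)
    moreover have "?G \<subseteq> Pow UNIV" by simp
    moreover have "A \<in> sigma_sets UNIV ?G" using that by (simp only: gen)
    ultimately show ?thesis
    proof (induction A rule: sigma_sets_induct_disjoint)
      case (basic A)
      then obtain a b where A: "A = {a<..<b}" by auto
      \<comment> \<open>The generator contains all open intervals, the hypothesis only those within
        [0,T]; clipping does not change the integral.\<close>
      have "(LINT t|?M. indicator A t * g t) = (LINT t|?M. indicator {max a 0<..<min b T} t * g t)"
        by (rule Bochner_Integration.integral_cong) (auto simp: A indicator_def)
      then show ?case using 0[of "max a 0" "min b T"] by simp
    next
      case (compl A)
      then have "A \<in> sets lebesgue" by (simp add: gen)
      have "(LINT t|?M. g t) = (LINT t|?M. indicator {0<..<T} t * g t)"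
        by (rule Bochner_Integration.integral_cong) auto
      also have "\<dots> = 0" by (rule 0) auto
      finally have g0: "(LINT t|?M. g t) = 0" .
      have "(LINT t|?M. indicator (UNIV - A) t * g t) = (LINT t|?M. g t - indicator A t * g t)"
        by (rule Bochner_Integration.integral_cong) (auto simp: indicator_def)
      also have "\<dots> = 0" using compl.IH g0 g intg[OF \<open>A \<in> sets lebesgue\<close>] by simp
      finally show ?case .
    next
      case (union A)
      have Ai: "A i \<in> sets lebesgue" for i
        using union.hyps by (auto simp: gen)
      then have U: "(\<Union>i. A i) \<in> sets lebesgue" by auto
      have "(LINT t|?M. indicator (\<Union>i. A i) t * g t) = set_lebesgue_integral ?M (\<Union>i. A i \<inter> {0<..<T}) g"
        unfolding set_lebesgue_integral_def
        by (rule Bochner_Integration.integral_cong) (auto simp: indicator_def)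
      also have "\<dots> = (\<Sum>i. set_lebesgue_integral ?M (A i \<inter> {0<..<T}) g)"
      proof (rule lebesgue_integral_countable_add)
        show "A i \<inter> {0<..<T} \<in> sets ?M" for i by (rule iM[OF Ai])
        show "(A i \<inter> {0<..<T}) \<inter> (A j \<inter> {0<..<T}) = {}" if "i \<noteq> j" for i j
          using union.hyps(1) that by (auto simp: disjoint_family_on_def)
        have "(\<Union>i. A i \<inter> {0<..<T}) \<in> sets ?M" by (intro sets.countable_UN) (use iM[OF Ai] in auto)
        then show "set_integrable ?M (\<Union>i. A i \<inter> {0<..<T}) g"
          unfolding set_integrable_def by (rule integrable_mult_indicator[OF _ g])
      qed
      also have "\<dots> = (\<Sum>i. LINT t|?M. indicator (A i) t * g t)"
        unfolding set_lebesgue_integral_def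
        by (intro suminf_cong Bochner_Integration.integral_cong) (auto simp: indicator_def)
      finally show ?case using union.IH by simp
    next
      case empty
      then show ?case by simp
    qed
  qed
  have "set_lebesgue_integral ?M A g = 0" if "A \<in> sets ?M" for A
  proof -
    \<comment> \<open>A Lebesgue set is a Borel set up to a subset of a Borel null set, so the Borel
      case carries over.\<close>
    from that have "A \<in> sets lebesgue" by (simp add: sets_restrict_space_iff)
    then obtain S N N' where A: "A = S \<union> N" "N \<subseteq> N'" "N' \<in> null_sets lborel" "S \<in> sets lborel"
      by (rule sets_completionE)
    have "AE t in lebesgue. t \<notin> N'" by (rule AE_not_in[OF null_sets_completionI[OF A(3)]])
    then have ae: "AE t in ?M. t \<notin> N'" by (subst AE_restrict_space_iff) auto
    have "(LINT t|?M. indicator A t *\<^sub>R g t) = (LINT t|?M. indicator S t * g t)"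
    proof (rule integral_cong_AE)
      show "(\<lambda>t. indicator A t *\<^sub>R g t) \<in> borel_measurable ?M"
        using intg[OF \<open>A \<in> sets lebesgue\<close>] by auto
      show "(\<lambda>t. indicator S t * g t) \<in> borel_measurable ?M"
        using intg[of S] A by auto
      show "AE t in ?M. indicator A t *\<^sub>R g t = indicator S t * g t"
        using ae by eventually_elim (use A in \<open>auto simp: indicator_def\<close>)
    qed
    then show ?thesis using bint[of S] A by (simp add: set_lebesgue_integral_def)
  qed
  then show ?thesis by (rule density_zero[OF g])
qed

text \<open>Bumps bounded by 1 converge pointwise to the indicator of any open subinterval, so
  dominated convergence with bound |g| shows that \<open>g\<close> integrates to 0 over all of
  them.\<close>

lemma L2_fundamental_lemma:
  assumes g: "g \<in> L2 T" and orth: "\<And>\<phi>. bump T \<phi> \<Longrightarrow> L2_inner T g \<phi> = 0"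
  shows "AE t in interval_measure T. g t = 0"
proof (rule set_integral_zero_imp_AE_zero[OF L2_integrable[OF g]])
  fix a b :: real assume ab: "0 \<le> a" "b \<le> T"
  obtain \<psi> where \<psi>: "\<And>j::nat. bump T (\<psi> j)" "\<And>j t. \<bar>\<psi> j t\<bar> \<le> 1" 
    "\<And>t. (\<lambda>j. \<psi> j t) \<longlonglongrightarrow> indicator {a<..<b} t"
    using bump_approximates_indicator[OF ab] by metis
  note [measurable] = L2_D(1)[OF g] L2_D(1)[OF bump_L2[OF \<psi>(1)]]
  have "(\<lambda>j. LINT t|interval_measure T. g t * \<psi> j t) \<longlonglongrightarrow> (LINT t|interval_measure T. g t * indicator {a<..<b} t)"
  proof (rule integral_dominated_convergence)
    show "integrable (interval_measure T) (\<lambda>t. \<bar>g t\<bar>)" using L2_integrable[OF g] by simp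
    show "(\<lambda>t. g t * indicator {a<..<b} t) \<in> borel_measurable (interval_measure T)"
      by (rule borel_measurable_LIMSEQ_metric[where f="\<lambda>j t. g t * \<psi> j t"])
        (measurable, use \<psi> in \<open>auto intro: tendsto_mult_left\<close>)
  qed (use \<psi> in \<open>auto intro!: tendsto_mult_left mult_left_le simp: abs_mult\<close>)
  moreover have "(LINT t|interval_measure T. g t * \<psi> j t) = 0" for j
    using orth[OF \<psi>(1)] by (simp add: L2_inner_def)
  ultimately show "(LINT t|interval_measure T. indicator {a<..<b} t * g t) = 0"
    by (simp add: LIMSEQ_const_iff mult.commute)
qed

section \<open>Weak derivatives and primitives\<close>

text \<open>Written exactly as the integrals in \<open>V_L2\<close>. For t <= 0 the interval is
  empty and the value is 0, which is the convention used there for t <= L.\<close>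

definition primitive :: "(real \<Rightarrow> real) \<Rightarrow> real \<Rightarrow> real" where
  "primitive a t = (LINT s|lebesgue_on {0<..<t}. a s)"

text \<open>Moves the dependence on \<open>t\<close> from the measure into the integrand, so that
  linearity and Fubini apply over one fixed measure space.\<close>

lemma primitive_eq_indicator:
  assumes "t \<le> T"
  shows "primitive a t = (LINT s|interval_measure T. indicator {..<t} s * a s)"
proof -
  have "primitive a t = (LINT s|lebesgue. indicator {0<..<t} s *\<^sub>R a s)"
    unfolding primitive_def by (rule integral_restrict_space) simp
  also have "\<dots> = (LINT s|lebesgue. indicator {0<..<T} s *\<^sub>R (indicator {..<t} s * a s))"
    by (rule Bochner_Integration.integral_cong) (use assms in \<open>auto simp: indicator_def\<close>)
  also have "\<dots> = (LINT s|interval_measure T. indicator {..<t} s * a s)"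
    by (rule integral_restrict_space[symmetric]) simp
  finally show ?thesis .
qed

lemma integrable_interval_indicator:
  fixes a :: "real \<Rightarrow> real"
  assumes "integrable (interval_measure T) a" "A \<in> sets borel"
  shows "integrable (interval_measure T) (\<lambda>s. indicator A s * a s)"
proof (rule Bochner_Integration.integrable_bound[OF assms(1)])
  have "(\<lambda>s. indicat_real A s) \<in> borel_measurable lebesgue" 
    using assms(2) by (intro borel_measurable_indicator) auto
  then have [measurable]: "(\<lambda>s. indicat_real A s) \<in> borel_measurable (interval_measure T)"
    by (rule measurable_restrict_space1)
  have [measurable]: "a \<in> borel_measurable (interval_measure T)" using assms(1) by simp
  show "(\<lambda>s. indicat_real A s * a s) \<in> borel_measurable (interval_measure T)" by measurable
qed (auto simp: indicator_def)

lemma primitive_lincomb: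
  assumes "f \<in> L2 T" "g \<in> L2 T" "t \<le> T"
  shows "primitive (\<lambda>s. a * f s + b * g s) t = a * primitive f t + b * primitive g t"
  using integrable_interval_indicator[OF L2_integrable[OF assms(1)], of "{..<t}"]
    integrable_interval_indicator[OF L2_integrable[OF assms(2)], of "{..<t}"]
  by (simp add: primitive_eq_indicator[OF assms(3)] ring_distribs mult.left_commute[of _ a] mult.left_commute[of _ b])

lemma primitive_eq_integral:
  assumes "a \<in> L2 T" "t \<le> T"
  shows "primitive a t = integral {0..t} a"
proof -
  have "integrable (lebesgue_on {0<..<t}) a"
  proof -
    have "integrable (interval_measure T) (\<lambda>s. indicator {..<t} s * a s)"
      by (rule integrable_interval_indicator[OF L2_integrable[OF assms(1)]]) simp
    then have "integrable lebesgue (\<lambda>s. indicator {0<..<T} s *\<^sub>R (indicator {..<t} s * a s))"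
      by (subst (asm) integrable_restrict_space) auto
    also have "(\<lambda>s. indicator {0<..<T} s *\<^sub>R (indicator {..<t} s * a s)) = (\<lambda>s. indicator {0<..<t} s *\<^sub>R a s)"
      using assms(2) by (auto simp: indicator_def)
    finally show ?thesis by (subst integrable_restrict_space) auto
  qed
  then have "primitive a t = integral {0<..<t} a"
    unfolding primitive_def by (rule lebesgue_integral_eq_integral) simp
  also have "\<dots> = integral {0..t} a" by (rule integral_open_interval_real[symmetric])
  finally show ?thesis .
qed

lemma L2_integrable_on:
  assumes "a \<in> L2 T" shows "a integrable_on {0..T}"
proof -
  have "a integrable_on {0<..<T}" 
    using integrable_on_lebesgue_on[OF L2_integrable[OF assms]] by simp
  then show ?thesis by (simp add: integrable_on_open_interval_real)
qed

lemma primitive_continuous: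
  assumes "a \<in> L2 T" shows "continuous_on {0..T} (primitive a)"
  using indefinite_integral_continuous_1[OF L2_integrable_on[OF assms]]
  by (rule continuous_on_eq) (use assms in \<open>auto simp: primitive_eq_integral\<close>)

lemma primitive_L2: "a \<in> L2 T \<Longrightarrow> primitive a \<in> L2 T"
  by (rule continuous_L2[OF primitive_continuous])

lemma primitive_deriv:
  assumes "\<And>t. (f has_field_derivative f' t) (at t)" "continuous_on UNIV f'" "0 \<le> t"
  shows "primitive f' t = f t - f 0"
proof -
  have "f' \<in> L2 t" by (rule continuous_L2) (use assms(2) continuous_on_subset in blast)
  then have "primitive f' t = integral {0..t} f'" by (rule primitive_eq_integral) simp
  also have "(f' has_integral (f t - f 0)) {0..t}"
    using assms(1,3) 
    by (intro fundamental_theorem_of_calculus)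
      (auto simp: has_real_derivative_iff_has_vector_derivative[symmetric] intro: has_field_derivative_at_within)
  then have "integral {0..t} f' = f t - f 0" by (rule integral_unique)
  finally show ?thesis .
qed

text \<open>Fubini for a(s) b(t) over the triangle s < t: integrating first in \<open>s\<close>
  gives \<open>primitive a\<close>, integrating first in \<open>t\<close> gives the integral of
  \<open>b\<close> from \<open>s\<close> to \<open>T\<close>. No differentiability is
  involved.\<close>

lemma primitive_by_parts:
  assumes a: "a \<in> L2 T" and b: "b \<in> L2 T"
  shows "L2_inner T (primitive a) b + L2_inner T a (primitive b) = primitive a T * primitive b T"
proof -
  let ?M = "interval_measure T"
  interpret finite_measure ?M by (rule finite_measure_interval)
  interpret pair_sigma_finite ?M ?M ..
  note [measurable] = L2_D(1)[OF a] L2_D(1)[OF b]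
  have [measurable]: "(\<lambda>x. x) \<in> borel_measurable ?M"
    by (intro measurable_restrict_space1 measurable_completion) simp
  define k :: "real \<Rightarrow> real \<Rightarrow> real" where "k s t = (if s < t then 1 else 0)" for s t
  have [measurable]: "(\<lambda>x. k (fst x) (snd x)) \<in> borel_measurable (?M \<Otimes>\<^sub>M ?M)"
    unfolding k_def by measurable
  have "integrable (?M \<Otimes>\<^sub>M ?M) (\<lambda>x. a (fst x) * b (snd x))"
  proof (rule Fubini_integrable)
    show "(\<lambda>x. a (fst x) * b (snd x)) \<in> borel_measurable (?M \<Otimes>\<^sub>M ?M)" by measurable
    show "integrable ?M (\<lambda>x. LINT y|?M. norm (a (fst (x, y)) * b (snd (x, y))))"
      using L2_integrable[OF a] by (simp add: abs_mult)
    show "AE x in ?M. integrable ?M (\<lambda>y. a (fst (x, y)) * b (snd (x, y)))"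
      using L2_integrable[OF b] by simp
  qed
  then have "integrable (?M \<Otimes>\<^sub>M ?M) (\<lambda>x. k (fst x) (snd x) * (a (fst x) * b (snd x)))"
    by (rule Bochner_Integration.integrable_bound) (auto simp: k_def)
  then have "integrable (?M \<Otimes>\<^sub>M ?M) (\<lambda>(s, t). k s t * (a s * b t))"
    by (simp add: case_prod_unfold)
  from Fubini_integral[OF this]
  have "(LINT t|?M. LINT s|?M. k s t * (a s * b t)) = (LINT s|?M. LINT t|?M. k s t * (a s * b t))" .
  also have "(LINT t|?M. LINT s|?M. k s t * (a s * b t)) = L2_inner T (primitive a) b"
    unfolding L2_inner_def
  proof (rule Bochner_Integration.integral_cong)
    fix t assume "t \<in> space ?M"
    then have "primitive a t = (LINT s|?M. k s t * a s)"
      by (subst primitive_eq_indicator[of t T]) (auto simp: k_def indicator_def intro!: Bochner_Integration.integral_cong)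
    then show "(LINT s|?M. k s t * (a s * b t)) = primitive a t * b t"
      by (simp add: mult.assoc[symmetric])
  qed simp
  also have "(LINT s|?M. LINT t|?M. k s t * (a s * b t)) = (LINT s|?M. a s * (primitive b T - primitive b s))"
  proof (rule Bochner_Integration.integral_cong)
    fix s assume s: "s \<in> space ?M"
    \<comment> \<open>The kernel and the complement of the indicator of t < s differ only on the
      diagonal t = s.\<close>
    have "AE t in lebesgue. t \<noteq> s" by (rule AE_completion[OF AE_lborel_singleton])
    then have ae: "AE t in ?M. t \<noteq> s" by (subst AE_restrict_space_iff) auto
    have "(LINT t|?M. k s t * b t) = (LINT t|?M. b t - indicator {..<s} t * b t)"
    proof (rule integral_cong_AE)
      show "(\<lambda>t. k s t * b t) \<in> borel_measurable ?M" unfolding k_def by measurable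
      show "(\<lambda>t. b t - indicat_real {..<s} t * b t) \<in> borel_measurable ?M" 
        using integrable_interval_indicator[OF L2_integrable[OF b], of "{..<s}"] by measurable
      show "AE t in ?M. k s t * b t = b t - indicator {..<s} t * b t"
        using ae by eventually_elim (auto simp: k_def indicator_def)
    qed
    also have "\<dots> = primitive b T - primitive b s"
      using s integrable_interval_indicator[OF L2_integrable[OF b], of "{..<s}"] L2_integrable[OF b]
      by (simp add: primitive_eq_indicator[of s T] primitive_def[of b T])
    finally show "(LINT t|?M. k s t * (a s * b t)) = a s * (primitive b T - primitive b s)"
      by (simp add: mult.left_commute[of _ "a s"])
  qed simp
  also have "\<dots> = (LINT s|?M. a s * primitive b T - a s * primitive b s)"
    by (simp add: right_diff_distrib)
  also have "\<dots> = primitive a T * primitive b T - L2_inner T a (primitive b)"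
    using L2_integrable[OF a] L2_mult_integrable[OF a primitive_L2[OF b]]
    by (simp add: L2_inner_def primitive_def)
  finally show ?thesis by simp
qed

section \<open>Weak derivatives tested against smooth functions\<close>

lemma test_function_props:
  assumes "\<phi> \<in> test_functions T" "T > 0"
  shows "deriv \<phi> \<in> L2 T" "\<phi> \<in> L2 T" "primitive (deriv \<phi>) T = 0" 
    "t \<ge> 0 \<Longrightarrow> primitive (deriv \<phi>) t = \<phi> t"
proof -
  obtain K where K: "K \<subseteq> {0<..<T}" "\<forall>t. t \<notin> K \<longrightarrow> \<phi> t = 0" 
    and d: "\<And>k t. (deriv ^^ k) \<phi> differentiable (at t)"
    using assms by (auto simp: test_functions_def)
  have D: "(\<phi> has_field_derivative deriv \<phi> t) (at t)" for t
    using d[of 0 t] by (simp add: DERIV_deriv_iff_real_differentiable)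
  have c: "continuous_on S (deriv \<phi>)" for S
    using d[of 1] by (auto intro!: continuous_at_imp_continuous_on differentiable_imp_continuous_within)
  have 0: "\<phi> 0 = 0" "\<phi> T = 0" using K by auto
  show p: "primitive (deriv \<phi>) t = \<phi> t" if "t \<ge> 0" for t
    using primitive_deriv[OF D c that] 0 by simp
  show "primitive (deriv \<phi>) T = 0" using p[of T] 0 assms(2) by simp
  show "deriv \<phi> \<in> L2 T" by (rule continuous_L2[OF c])
  show "\<phi> \<in> L2 T" 
    using D by (intro continuous_L2 continuous_at_imp_continuous_on) (auto intro: DERIV_isCont)
qed

lemma L2_inner_primitive_test:
  assumes "g \<in> L2 T" "\<phi> \<in> test_functions T" "T > 0"
  shows "L2_inner T (primitive g) (deriv \<phi>) = - L2_inner T g \<phi>"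
proof -
  have "L2_inner T g (primitive (deriv \<phi>)) = L2_inner T g \<phi>"
    unfolding L2_inner_def
    by (rule Bochner_Integration.integral_cong) (auto simp: test_function_props[OF assms(2,3)])
  then show ?thesis
    using primitive_by_parts[OF assms(1) test_function_props(1)[OF assms(2,3)]] 
      test_function_props(3)[OF assms(2,3)] by simp
qed

lemma L2_inner_const_test:
  assumes "\<phi> \<in> test_functions T" "T > 0"
  shows "L2_inner T (\<lambda>_. c) (deriv \<phi>) = 0"
  using test_function_props(3)[OF assms] by (simp add: L2_inner_def primitive_def)

lemma has_weak_deriv_primitive:
  assumes "g \<in> L2 T" "T > 0"
  shows "has_weak_deriv T (\<lambda>t. primitive g t + c) g"
  unfolding has_weak_deriv_def
proof
  fix \<phi> assume \<phi>: "\<phi> \<in> test_functions T"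
  have "L2_inner T (\<lambda>t. 1 * primitive g t + 1 * c) (deriv \<phi>) 
     = 1 * L2_inner T (primitive g) (deriv \<phi>) + 1 * L2_inner T (\<lambda>_. c) (deriv \<phi>)"
    by (rule L2_inner_lincomb_left) (use assms test_function_props[OF \<phi>] primitive_L2 in auto)
  then show "L2_inner T (\<lambda>t. primitive g t + c) (deriv \<phi>) = - L2_inner T g \<phi>"
    using L2_inner_primitive_test[OF assms(1) \<phi> assms(2)] L2_inner_const_test[OF \<phi> assms(2)] by simp
qed

text \<open>Vanishing mean is what makes the antiderivative zero to the right of the support as well
  as to the left. Its smoothness is immediate from the \<open>antideriv\<close> rule of the
  inductive class.\<close>

lemma bump_antiderivative:
  assumes \<phi>: "bump T \<phi>" and 0: "primitive \<phi> T = 0" and "T > 0"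
  obtains \<Phi> where "bump T \<Phi>" "deriv \<Phi> = \<phi>"
proof -
  obtain \<alpha> \<beta> where sm: "elem_smooth \<phi>" and ab: "0 < \<alpha>" "\<beta> < T" and z: "\<And>t. t \<notin> {\<alpha>..\<beta>} \<Longrightarrow> \<phi> t = 0"
    using \<phi> by (auto simp: bump_def)
  \<comment> \<open>Infinite endpoints give an antiderivative on the whole line, as test functions
    must be smooth there and not only on (0,T).\<close>
  have "\<exists>F. \<forall>x::real. -\<infinity> < ereal x \<longrightarrow> ereal x < \<infinity> \<longrightarrow> (F has_vector_derivative \<phi> x) (at x)"
  proof (rule einterval_antiderivative)
    fix x :: real show "isCont \<phi> x"
      using elem_smooth_differentiable[OF sm] differentiable_imp_continuous_within by blast
  qed simp
  then obtain F where "\<And>x. (F has_vector_derivative \<phi> x) (at x)" by auto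
  then have F: "(F has_field_derivative \<phi> x) (at x)" for x
    by (simp add: has_real_derivative_iff_has_vector_derivative)
  define \<Phi> where "\<Phi> t = F t - F 0" for t
  have D: "(\<Phi> has_field_derivative \<phi> x) (at x)" for x
    unfolding \<Phi>_def[abs_def] by (auto intro!: derivative_eq_intros F)
  have sm\<Phi>: "elem_smooth \<Phi>" using sm D by (rule elem_smooth.antideriv)
  have const: "\<Phi> x = \<Phi> y" if "\<And>t. t \<in> S \<Longrightarrow> \<phi> t = 0" "convex S" "x \<in> S" "y \<in> S" for S x y
  proof -
    have "\<exists>c. \<forall>x\<in>S. \<Phi> x = c"
      using D that(1) by (intro has_field_derivative_zero_constant that(2)) 
        (metis has_field_derivative_at_within)
    then show ?thesis using that by auto
  qed
  have "\<Phi> T = 0"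
    using primitive_deriv[OF D elem_smooth_continuous[OF sm], of T] 0 \<open>T > 0\<close> by (simp add: \<Phi>_def)
  have "\<Phi> t = 0" if "t \<notin> {\<alpha>..\<beta>}" for t
  proof (cases "t < \<alpha>")
    case True
    have "\<Phi> t = \<Phi> 0" by (rule const[of "{..<\<alpha>}"]) (use True ab z in auto)
    then show ?thesis by (simp add: \<Phi>_def)
  next
    case False
    have "\<Phi> t = \<Phi> T" by (rule const[of "{\<beta><..}"]) (use False that ab z in auto)
    then show ?thesis using \<open>\<Phi> T = 0\<close> by simp
  qed
  then have "bump T \<Phi>" using sm\<Phi> ab unfolding bump_def by blast
  moreover have "deriv \<Phi> = \<phi>" using D by (auto intro: DERIV_imp_deriv)
  ultimately show ?thesis by (rule that)
qed

text \<open>Subtracting from a bump the right multiple of one fixed bump \<psi> of nonzero mean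
  leaves mean zero, hence the derivative of a bump, to which \<open>h\<close> is orthogonal. So
  \<open>h\<close> acts on bumps as the constant read off from \<psi>.\<close>

lemma L2_du_Bois_Reymond:
  assumes h: "h \<in> L2 T" and "T > 0" and orth: "\<And>\<phi>. \<phi> \<in> test_functions T \<Longrightarrow> L2_inner T h (deriv \<phi>) = 0"
  shows "\<exists>c. AE t in interval_measure T. h t = c"
proof -
  have ip: "L2_inner T (\<lambda>_. c) \<psi> = c * primitive \<psi> T" for \<psi> c
    by (simp add: L2_inner_def primitive_def)
  \<comment> \<open>Otherwise the constant 1 would be orthogonal to every bump and so vanish almost
    everywhere.\<close>
  have "\<exists>\<psi>. bump T \<psi> \<and> primitive \<psi> T \<noteq> 0"
  proof (rule ccontr)
    assume *: "\<not> (\<exists>\<psi>. bump T \<psi> \<and> primitive \<psi> T \<noteq> 0)"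
    have "AE t in interval_measure T. (1::real) = 0"
      by (rule L2_fundamental_lemma[of "\<lambda>_. 1"]) (use * in \<open>auto simp: ip\<close>)
    then show False 
      using L2_norm_eq_0_iff[of "\<lambda>_. 1" T] \<open>T > 0\<close> 
      by (simp add: L2_norm_def L2_inner_self measure_restrict_space)
  qed
  then obtain \<psi> where \<psi>: "bump T \<psi>" "primitive \<psi> T \<noteq> 0" by blast
  define c where "c = L2_inner T h \<psi> / primitive \<psi> T"
  have "AE t in interval_measure T. h t - c = 0"
  proof (rule L2_fundamental_lemma)
    show "(\<lambda>t. h t - c) \<in> L2 T" by (intro L2_diff h) simp
    fix \<phi> assume \<phi>: "bump T \<phi>"
    define \<eta> where "\<eta> t = 1 * \<phi> t + (- primitive \<phi> T / primitive \<psi> T) * \<psi> t" for t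
    have "bump T \<eta>" unfolding \<eta>_def[abs_def] by (rule bump_lincomb[OF \<phi> \<psi>(1)])
    moreover have "primitive \<eta> T = 0"
      unfolding \<eta>_def[abs_def] 
      by (subst primitive_lincomb[OF bump_L2[OF \<phi>] bump_L2[OF \<psi>(1)]]) (use \<psi> in auto)
    ultimately obtain X where "bump T X" "deriv X = \<eta>"
      using \<open>T > 0\<close> by (rule bump_antiderivative)
    then have "L2_inner T h \<eta> = 0" using orth[OF bump_test_function] by blast
    then have "L2_inner T h \<phi> = c * primitive \<phi> T"
      unfolding \<eta>_def[abs_def] 
      by (subst (asm) L2_inner_lincomb_right[OF bump_L2[OF \<phi>] bump_L2[OF \<psi>(1)] h])
        (use \<psi> in \<open>simp add: c_def field_simps\<close>)
    then show "L2_inner T (\<lambda>t. h t - c) \<phi> = 0"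
      by (subst L2_inner_diff_left) (use h bump_L2[OF \<phi>] in \<open>auto simp: ip\<close>)
  qed
  then show ?thesis by (intro exI[of _ c]) auto
qed

lemma has_weak_deriv_unique:
  assumes "has_weak_deriv T q g" "has_weak_deriv T q g'" "g \<in> L2 T" "g' \<in> L2 T"
  shows "AE t in interval_measure T. g t = g' t"
proof -
  have "AE t in interval_measure T. g t - g' t = 0"
  proof (rule L2_fundamental_lemma)
    show "(\<lambda>t. g t - g' t) \<in> L2 T" by (intro L2_diff assms)
    fix \<phi> assume \<phi>: "bump T \<phi>"
    show "L2_inner T (\<lambda>t. g t - g' t) \<phi> = 0"
      using assms(1,2) bump_test_function[OF \<phi>] 
      by (subst L2_inner_diff_left) (auto simp: has_weak_deriv_def assms bump_L2[OF \<phi>])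
  qed
  then show ?thesis by eventually_elim simp
qed

section \<open>Functions in H^1 with vanishing end value\<close>

lemma weak_deriv_props:
  assumes "q \<in> H1 T"
  shows "weak_deriv T q \<in> L2 T" "has_weak_deriv T q (weak_deriv T q)"
proof -
  have "\<exists>g. g \<in> L2 T \<and> has_weak_deriv T q g" using assms by (auto simp: H1_def)
  then have "weak_deriv T q \<in> L2 T \<and> has_weak_deriv T q (weak_deriv T q)"
    unfolding weak_deriv_def by (rule someI_ex)
  then show "weak_deriv T q \<in> L2 T" "has_weak_deriv T q (weak_deriv T q)" by auto
qed

text \<open>The squared difference is continuous and nonnegative with integral 0, hence zero on all
  of [0,T]. This reaches the endpoint T, which equality almost everywhere on the open interval does
  not mention.\<close>

lemma AE_eq_continuous_at_end:
  fixes f g :: "real \<Rightarrow> real"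
  assumes f: "continuous_on {0..T} f" and g: "continuous_on {0..T} g" 
    and ae: "AE t in interval_measure T. f t = g t" and "T > 0"
  shows "f T = g T"
proof -
  let ?h = "\<lambda>t. (f t - g t)\<^sup>2"
  have c: "continuous_on {0..T} ?h" by (intro continuous_intros f g)
  have "integral {0..T} ?h = primitive ?h T"
    by (rule primitive_eq_integral[symmetric, OF continuous_L2[OF c]]) simp
  also have "\<dots> = 0"
    unfolding primitive_def by (rule integral_eq_zero_AE) (use ae in auto)
  finally have "(?h has_integral 0) (cbox 0 T)"
    using integrable_integral[OF integrable_continuous_interval[OF c]] by simp
  from has_integral_0_cbox_imp_0[of 0 T ?h, OF _ _ this, of T] c \<open>T > 0\<close>
  show ?thesis by (simp add: box_real)
qed

lemma H1_end_D:
  assumes "v \<in> H1_end T"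
  shows "v \<in> H1 T" "v \<in> L2 T" "weak_deriv T v \<in> L2 T"
  using assms weak_deriv_props by (auto simp: H1_end_def H1_def)

text \<open>By du Bois-Reymond \<open>v\<close> differs from the primitive of its weak derivative by
  a constant; comparing continuous representatives at T, where that of \<open>v\<close> vanishes,
  determines it.\<close>

lemma H1_end_eq_primitive:
  assumes v: "v \<in> H1_end T" and "T > 0"
  shows "AE t in interval_measure T. v t = primitive (weak_deriv T v) t - primitive (weak_deriv T v) T"
proof -
  let ?g = "weak_deriv T v"
  note vD = H1_end_D[OF v]
  have "\<exists>c. AE t in interval_measure T. v t - primitive ?g t = c"
  proof (rule L2_du_Bois_Reymond)
    show "(\<lambda>t. v t - primitive ?g t) \<in> L2 T" by (intro L2_diff primitive_L2 vD)
    fix \<phi> assume \<phi>: "\<phi> \<in> test_functions T"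
    have "L2_inner T v (deriv \<phi>) = - L2_inner T ?g \<phi>"
      using weak_deriv_props(2)[OF vD(1)] \<phi> by (auto simp: has_weak_deriv_def)
    then show "L2_inner T (\<lambda>t. v t - primitive ?g t) (deriv \<phi>) = 0"
      using L2_inner_primitive_test[OF vD(3) \<phi> \<open>T > 0\<close>]
      by (subst L2_inner_diff_left) (auto simp: vD primitive_L2 test_function_props[OF \<phi> \<open>T > 0\<close>])
  qed fact
  then obtain c where c: "AE t in interval_measure T. v t - primitive ?g t = c" by blast
  obtain r where r: "continuous_on {0..T} r" "AE t in interval_measure T. v t = r t" "r T = 0"
    using v by (auto simp: H1_end_def)
  have "AE t in interval_measure T. r t = primitive ?g t + c"
    using c r(2) by eventually_elim simp
  then have "r T = primitive ?g T + c"
    by (intro AE_eq_continuous_at_end r \<open>T > 0\<close> continuous_intros primitive_continuous vD)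
  then have "c = - primitive ?g T" using r by simp
  then show ?thesis using c by auto
qed

text \<open>The inverse, up to null sets, of the weak derivative on \<open>H1_end T\<close>.\<close>

definition end_primitive :: "real \<Rightarrow> (real \<Rightarrow> real) \<Rightarrow> real \<Rightarrow> real" where
  "end_primitive T g t = primitive g t - primitive g T"

lemma end_primitive_H1_end:
  assumes g: "g \<in> L2 T" and "T > 0"
  shows "end_primitive T g \<in> H1_end T" 
    "AE t in interval_measure T. weak_deriv T (end_primitive T g) t = g t"
proof -
  have c: "continuous_on {0..T} (end_primitive T g)"
    unfolding end_primitive_def[abs_def] by (intro continuous_intros primitive_continuous g)
  have w: "has_weak_deriv T (end_primitive T g) g"
    using has_weak_deriv_primitive[OF assms, of "- primitive g T"] by (simp add: end_primitive_def[abs_def])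
  show H: "end_primitive T g \<in> H1_end T"
    using c w g continuous_L2[OF c] unfolding H1_end_def H1_def 
    by (auto intro!: exI[of _ "end_primitive T g"] simp: end_primitive_def)
  show "AE t in interval_measure T. weak_deriv T (end_primitive T g) t = g t"
    using H1_end_D[OF H] g w by (intro has_weak_deriv_unique[OF weak_deriv_props(2) w])
qed

text \<open>The weak derivative is selected by \<open>SOME\<close>, so its linearity holds only
  almost everywhere and rests on uniqueness.\<close>

lemma H1_end_lincomb:
  assumes u: "u \<in> H1_end T" and v: "v \<in> H1_end T" and "T > 0"
  shows "(\<lambda>t. a * u t + b * v t) \<in> H1_end T"
    "AE t in interval_measure T. weak_deriv T (\<lambda>t. a * u t + b * v t) t = a * weak_deriv T u t + b * weak_deriv T v t"
proof -
  note uD = H1_end_D[OF u] and vD = H1_end_D[OF v]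
  have L: "(\<lambda>t. a * weak_deriv T u t + b * weak_deriv T v t) \<in> L2 T" by (intro L2_lincomb uD vD)
  have w: "has_weak_deriv T (\<lambda>t. a * u t + b * v t) (\<lambda>t. a * weak_deriv T u t + b * weak_deriv T v t)"
    unfolding has_weak_deriv_def
  proof
    fix \<phi> assume \<phi>: "\<phi> \<in> test_functions T"
    note p = test_function_props[OF \<phi> \<open>T > 0\<close>]
    show "L2_inner T (\<lambda>t. a * u t + b * v t) (deriv \<phi>) = - L2_inner T (\<lambda>t. a * weak_deriv T u t + b * weak_deriv T v t) \<phi>"
      using weak_deriv_props(2)[OF uD(1)] weak_deriv_props(2)[OF vD(1)] \<phi>
      by (simp add: L2_inner_lincomb_left uD vD p has_weak_deriv_def)
  qed
  obtain r where r: "continuous_on {0..T} r" "AE t in interval_measure T. u t = r t" "r T = 0"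
    using u by (auto simp: H1_end_def)
  obtain s where s: "continuous_on {0..T} s" "AE t in interval_measure T. v t = s t" "s T = 0"
    using v by (auto simp: H1_end_def)
  have "AE t in interval_measure T. a * u t + b * v t = a * r t + b * s t"
    using r(2) s(2) by eventually_elim simp
  moreover have "continuous_on {0..T} (\<lambda>t. a * r t + b * s t)" by (intro continuous_intros r s)
  ultimately have "\<exists>c. continuous_on {0..T} c \<and> (AE t in interval_measure T. a * u t + b * v t = c t) \<and> c T = 0"
    using r(3) s(3) by (intro exI[of _ "\<lambda>t. a * r t + b * s t"]) auto
  then show H: "(\<lambda>t. a * u t + b * v t) \<in> H1_end T"
    using L w L2_lincomb[OF uD(2) vD(2), of a b] unfolding H1_end_def H1_def by blast
  show "AE t in interval_measure T. weak_deriv T (\<lambda>t. a * u t + b * v t) t = a * weak_deriv T u t + b * weak_deriv T v t"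
    using H1_end_D[OF H] L w by (intro has_weak_deriv_unique[OF weak_deriv_props(2) w])
qed

section \<open>The delay operator\<close>

definition delay :: "real \<Rightarrow> (real \<Rightarrow> real) \<Rightarrow> real \<Rightarrow> real" where
  "delay L f t = (if L < t then f (t - L) else 0)"

lemma delay_measurable:
  assumes "f \<in> borel_measurable (interval_measure T)" "L > 0"
  shows "delay L f \<in> borel_measurable (interval_measure T)"
proof -
  \<comment> \<open>\<open>f\<close> is measurable only relative to (0,T); extended by 0 it can be
    translated on the whole line.\<close>
  define F where "F x = (if x \<in> {0<..<T} then f x else 0)" for x
  have "F \<in> borel_measurable lebesgue"
    unfolding F_def by (rule borel_measurable_if_I[OF assms(1)]) simp
  then have "(\<lambda>x. F (- L + 1 *\<^sub>R x)) \<in> borel_measurable lebesgue"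
    by (rule borel_measurable_affine) simp
  then have "(\<lambda>x. F (- L + 1 *\<^sub>R x)) \<in> borel_measurable (interval_measure T)"
    by (rule measurable_restrict_space1)
  then show ?thesis
    by (subst measurable_lebesgue_cong[of _ _ "\<lambda>x. F (- L + 1 *\<^sub>R x)"]) 
      (use assms(2) in \<open>auto simp: F_def delay_def\<close>)
qed

lemma delay_integral:
  assumes f: "integrable (interval_measure T) f" and "L > 0"
  shows "integrable (interval_measure T) (delay L f)"
    "(LINT t|interval_measure T. delay L f t) = (LINT t|interval_measure T. indicator {..<T-L} t * f t)"
proof -
  \<comment> \<open>Only the part of \<open>f\<close> on (0, T - L) survives the delay; the rest is
    shifted beyond T.\<close>
  define H where "H x = indicator {0<..<T} x *\<^sub>R (indicator {..<T-L} x * f x)" for x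
  have H: "integrable lebesgue H"
  proof -
    have "integrable (interval_measure T) (\<lambda>x. indicator {..<T-L} x * f x)"
      by (rule integrable_interval_indicator[OF f]) simp
    then show ?thesis unfolding H_def[abs_def] by (subst (asm) integrable_restrict_space) auto
  qed
  have eq: "(\<lambda>x. H (- L + 1 * x)) = (\<lambda>x. indicator {0<..<T} x *\<^sub>R delay L f x)"
    using \<open>L > 0\<close> by (auto simp: H_def delay_def indicator_def)
  show "integrable (interval_measure T) (delay L f)"
    using lebesgue_integrable_real_affine[OF H, of 1 "-L"] unfolding eq
    by (subst integrable_restrict_space) auto
  have "(LINT t|interval_measure T. delay L f t) = (LINT x|lebesgue. H (- L + 1 * x))"
    unfolding eq by (rule integral_restrict_space) simp
  also have "\<dots> = (LINT x|lebesgue. H x)"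
    using lebesgue_integral_real_affine[of 1 H "-L"] by simp
  also have "\<dots> = (LINT t|interval_measure T. indicator {..<T-L} t * f t)"
    unfolding H_def by (rule integral_restrict_space[symmetric]) simp
  finally show "(LINT t|interval_measure T. delay L f t) = (LINT t|interval_measure T. indicator {..<T-L} t * f t)" .
qed

lemma delay_square: "(delay L f t)\<^sup>2 = delay L (\<lambda>t. (f t)\<^sup>2) t"
  by (simp add: delay_def)

lemma delay_L2:
  assumes "f \<in> L2 T" "L > 0" shows "delay L f \<in> L2 T"
  using delay_measurable[OF L2_D(1)[OF assms(1)] assms(2)] delay_integral(1)[OF L2_D(2)[OF assms(1)] assms(2)]
  by (simp add: L2_def delay_square)

lemma L2_norm_delay_le:
  assumes "f \<in> L2 T" "L > 0" shows "L2_norm T (delay L f) \<le> L2_norm T f"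
proof -
  have "L2_inner T (delay L f) (delay L f) \<le> L2_inner T f f"
    unfolding L2_inner_self delay_square delay_integral(2)[OF L2_D(2)[OF assms(1)] assms(2)]
    by (rule integral_mono[OF integrable_interval_indicator L2_D(2)])
      (use assms L2_D(2) in \<open>auto simp: indicator_def\<close>)
  then show ?thesis by (simp add: L2_norm_def)
qed

lemma delay_lincomb: "delay L (\<lambda>t. a * f t + b * g t) t = a * delay L f t + b * delay L g t"
  by (simp add: delay_def)

text \<open>The delay does not increase the L^2 norm, so it maps functions that vanish almost
  everywhere to such functions.\<close>

lemma delay_cong_AE:
  assumes "AE t in interval_measure T. f t = g t" "f \<in> L2 T" "g \<in> L2 T" "L > 0"
  shows "AE t in interval_measure T. delay L f t = delay L g t"
proof -
  have d: "(\<lambda>t. f t - g t) \<in> L2 T" by (intro L2_diff assms)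
  have "L2_norm T (\<lambda>t. f t - g t) = 0" using L2_norm_eq_0_iff[OF d] assms(1) by simp
  then have "L2_norm T (delay L (\<lambda>t. f t - g t)) = 0"
    using L2_norm_delay_le[OF d assms(4)] L2_norm_nonneg[of T "delay L (\<lambda>t. f t - g t)"] by linarith
  then have "AE t in interval_measure T. delay L (\<lambda>t. f t - g t) t = 0"
    using L2_norm_eq_0_iff[OF delay_L2[OF d assms(4)]] by simp
  then show ?thesis by eventually_elim (auto simp: delay_def split: if_splits)
qed

definition delay_sum :: "real \<Rightarrow> bdry \<Rightarrow> bdry" where
  "delay_sum L f = (\<lambda>t. 1/2 * fst f t + 1/2 * delay L (snd f) t, \<lambda>t. 1/2 * delay L (fst f) t + 1/2 * snd f t)"

text \<open>Delaying commutes with taking primitives because \<open>primitive\<close> is 0 at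
  nonpositive arguments.\<close>

lemma V_L2_eq_delay_sum:
  "V_L2 L w = delay_sum L (primitive (fst w), primitive (snd w))"
  by (auto simp: V_L2_def delay_sum_def delay_def primitive_def fun_eq_iff)

lemma delay_sum_L2:
  assumes "f \<in> L2_Sigma T" "L > 0" shows "delay_sum L f \<in> L2_Sigma T"
  using assms by (auto simp: L2_Sigma_def delay_sum_def intro!: L2_lincomb[of _ _ _ "1/2" "1/2", simplified] delay_L2)

lemma delay_sum_lincomb: "delay_sum L (lincomb a u b v) = lincomb a (delay_sum L u) b (delay_sum L v)"
  by (auto simp: delay_sum_def lincomb_def delay_lincomb fun_eq_iff algebra_simps)

lemma delay_sum_cong_AE:
  assumes "eq_AE T u v" "u \<in> L2_Sigma T" "v \<in> L2_Sigma T" "L > 0"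
  shows "eq_AE T (delay_sum L u) (delay_sum L v)"
proof -
  have *: "fst u \<in> L2 T" "snd u \<in> L2 T" "fst v \<in> L2 T" "snd v \<in> L2 T"
    using assms by (auto simp: L2_Sigma_def)
  have ae: "AE t in interval_measure T. fst u t = fst v t" "AE t in interval_measure T. snd u t = snd v t"
    using assms(1) by (auto simp: eq_AE_def)
  show ?thesis
    using ae delay_cong_AE[OF ae(1) *(1,3) assms(4)] delay_cong_AE[OF ae(2) *(2,4) assms(4)]
    unfolding eq_AE_def by eventually_elim (simp add: delay_sum_def)
qed

text \<open>Each component is at most the mean of the two component norms. This makes the operator
  bounded with constant 1 and supplies the continuity for the density argument.\<close>

lemma L2_Sigma_norm_delay_sum_le:
  assumes "f \<in> L2_Sigma T" "L > 0" shows "L2_Sigma_norm T (delay_sum L f) \<le> L2_Sigma_norm T f"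
proof -
  have *: "fst f \<in> L2 T" "snd f \<in> L2 T" using assms by (auto simp: L2_Sigma_def)
  let ?a = "L2_norm T (fst f)" and ?b = "L2_norm T (snd f)"
  have half: "L2_norm T (\<lambda>t. 1/2 * u t + 1/2 * v t) \<le> (L2_norm T u + L2_norm T v) / 2"
    if "u \<in> L2 T" "v \<in> L2 T" for u v
    using L2_norm_triangle[OF L2_scale[OF that(1), of "1/2"] L2_scale[OF that(2), of "1/2"]] 
      L2_norm_scale[OF that(1), of "1/2"] L2_norm_scale[OF that(2), of "1/2"] by simp
  have "L2_norm T (fst (delay_sum L f)) \<le> (?a + ?b) / 2" "L2_norm T (snd (delay_sum L f)) \<le> (?a + ?b) / 2"
    using half[OF *(1) delay_L2[OF *(2) assms(2)]] half[OF delay_L2[OF *(1) assms(2)] *(2)]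
      L2_norm_delay_le[OF *(1) assms(2)] L2_norm_delay_le[OF *(2) assms(2)]
    by (auto simp: delay_sum_def)
  then have "(L2_norm T (fst (delay_sum L f)))\<^sup>2 + (L2_norm T (snd (delay_sum L f)))\<^sup>2 \<le> ((?a + ?b) / 2)\<^sup>2 + ((?a + ?b) / 2)\<^sup>2"
    by (intro add_mono power_mono) auto
  also have "\<dots> \<le> ?a\<^sup>2 + ?b\<^sup>2"
    using zero_le_power2[of "?a - ?b"] by (simp add: power2_eq_square field_simps)
  finally show ?thesis unfolding L2_Sigma_norm_def by (rule real_sqrt_le_mono)
qed

section \<open>The lower bound for the delayed sum\<close>

lemma square_sum_weighted_ge:
  fixes x y p q :: real
  assumes "p > 0" "q > 0"
  shows "x\<^sup>2 * (1 - p / q) + y\<^sup>2 * (1 - q / p) \<le> (x + y)\<^sup>2"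
proof -
  \<comment> \<open>The defect is a square that vanishes for p x = - q y, that is, along the ground
    state with alternating signs.\<close>
  have "(x + y)\<^sup>2 - (x\<^sup>2 * (1 - p / q) + y\<^sup>2 * (1 - q / p)) = (p * x + q * y)\<^sup>2 / (p * q)"
    using assms by (simp add: power2_eq_square field_simps)
  also have "\<dots> \<ge> 0" using assms by simp
  finally show ?thesis by simp
qed

lemma delay_sum_lower_bound:
  assumes f: "f \<in> L2_Sigma T" and "L > 0" "T > 0" and n: "T \<le> real n * L"
  shows "(c_S n)\<^sup>2 * (L2_Sigma_norm T f)\<^sup>2 \<le> (L2_Sigma_norm T (delay_sum L f))\<^sup>2"
proof -
  let ?M = "interval_measure T"
  \<comment> \<open>Since (2 n + 1) \<theta> = pi/2, the sine below is symmetric about n + 1/2, so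
    \<phi>(n+1) = \<phi>(n): the end condition in the last slice.\<close>
  define \<theta> where "\<theta> = pi / (2 * (2 * real n + 1))"
  \<comment> \<open>\<open>\<phi>\<close> at the integers is the ground state of the tridiagonal matrix with diagonal \<open>2, \<dots>, 2, 1\<close>
    and off-diagonal entries \<open>-1\<close>, and \<open>k t\<close> is the index of the time slice containing \<open>t\<close>.\<close>
  define \<phi> where "\<phi> x = sin (2 * \<theta> * x)" for x :: real
  define k where "k t = real_of_int \<lceil>t / L\<rceil>" for t
  define \<alpha> where "\<alpha> t = 1 - \<phi> (k t - 1) / \<phi> (k t)" for t
  \<comment> \<open>The weight of a delayed value, indexed by the slice it comes from: at t - L the
    index is one lower, which turns \<phi>(k+1)/\<phi>(k) into the ratio \<phi>(k)/\<phi>(k-1) seen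
    at t.\<close>
  define \<beta> where "\<beta> t = 1 - \<phi> (k t + 1) / \<phi> (k t)" for t
  have \<theta>0: "\<theta> > 0" by (simp add: \<theta>_def)
  have \<theta>n: "(2 * real n + 1) * \<theta> = pi / 2" by (simp add: \<theta>_def field_simps)
  have k: "1 \<le> k t" "k t \<le> real n" if "0 < t" "t < T" for t
  proof -
    have "0 < \<lceil>t / L\<rceil>" using that \<open>L > 0\<close> by simp
    then show "1 \<le> k t" unfolding k_def by linarith
    have "t / L \<le> real n" using that n \<open>L > 0\<close> by (simp add: field_simps)
    then have "\<lceil>t / L\<rceil> \<le> int n" by (simp add: ceiling_le_iff)
    then show "k t \<le> real n" unfolding k_def by linarith
  qed
  have pos: "\<phi> x > 0" if "1 \<le> x" "x \<le> real n" for x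
  proof -
    have "2 * \<theta> * x \<le> 2 * \<theta> * real n" using that \<theta>0 by simp
    also have "\<dots> = pi / 2 - \<theta>" using \<theta>n by (simp add: algebra_simps)
    also have "\<dots> < pi" using \<theta>0 pi_gt_zero by linarith
    finally have "2 * \<theta> * x < pi" .
    then show ?thesis unfolding \<phi>_def using that \<theta>0 by (intro sin_gt_zero) auto
  qed
  \<comment> \<open>The increment is 2 sin \<theta> cos ((2 x + 1) \<theta>), whose angle stays
    within [0, pi/2] up to x = n. So \<phi> does not decrease from slice \<open>n\<close> to the
    fictitious slice n + 1.\<close>
  have mono: "\<phi> x \<le> \<phi> (x + 1)" if "0 \<le> x" "x \<le> real n" for x
  proof -
    have "\<phi> (x + 1) - \<phi> x = 2 * sin \<theta> * cos ((2 * x + 1) * \<theta>)"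
    proof -
      have "(2 * \<theta> * (x + 1) - 2 * \<theta> * x) / 2 = \<theta>" "(2 * \<theta> * (x + 1) + 2 * \<theta> * x) / 2 = (2 * x + 1) * \<theta>"
        by (simp_all add: field_simps)
      then show ?thesis unfolding \<phi>_def by (simp only: sin_diff_sin)
    qed
    moreover have "(2 * x + 1) * \<theta> \<le> (2 * real n + 1) * \<theta>"
      using that \<theta>0 by (intro mult_right_mono) auto
    then have "0 \<le> cos ((2 * x + 1) * \<theta>)"
      using that \<theta>0 \<theta>n by (intro cos_ge_zero) (auto intro: order_trans[of _ 0])
    moreover have "0 \<le> sin \<theta>"
    proof (rule sin_ge_zero)
      have "1 * \<theta> \<le> (2 * real n + 1) * \<theta>" using \<theta>0 by (intro mult_right_mono) auto
      then show "\<theta> \<le> pi" using \<theta>n pi_gt_zero by linarith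
    qed (use \<theta>0 in simp)
    ultimately show ?thesis by (smt (verit) mult_nonneg_nonneg)
  qed
  have sum: "\<phi> (x - 1) + \<phi> (x + 1) = 2 * \<phi> x * cos (2 * \<theta>)" for x
    unfolding \<phi>_def by (simp add: algebra_simps sin_add sin_diff)
  have cos2: "cos (2 * \<theta>) = 1 - 2 * (sin \<theta>)\<^sup>2" by (simp add: cos_double_sin)
  have \<alpha>\<beta>: "\<alpha> t + \<beta> t = 4 * (sin \<theta>)\<^sup>2" if "0 < t" "t < T" for t
  proof -
    have "\<alpha> t + \<beta> t = 2 - (\<phi> (k t - 1) + \<phi> (k t + 1)) / \<phi> (k t)"
      by (simp add: \<alpha>_def \<beta>_def add_divide_distrib)
    also have "\<dots> = 2 - 2 * cos (2 * \<theta>)" 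
      using pos[OF k[OF that]] by (simp add: sum)
    finally show ?thesis using cos2 by simp
  qed
  have \<beta>: "\<beta> t \<le> 0" if "0 < t" "t < T" for t
    using mono[of "k t"] pos[of "k t"] k[OF that] by (simp add: \<beta>_def)
  have \<alpha>: "0 \<le> \<alpha> t" "\<alpha> t \<le> 1" if "0 < t" "t < T" for t
  proof -
    show "0 \<le> \<alpha> t" using mono[of "k t - 1"] pos[of "k t"] k[OF that] by (simp add: \<alpha>_def)
    \<comment> \<open>In the first slice the ratio involves \<phi>(0) = 0, which the positivity
      statement for arguments from 1 to n does not cover.\<close>
    have "1 \<le> \<lceil>t / L\<rceil>" using k(1)[OF that] unfolding k_def by linarith
    then have "\<lceil>t / L\<rceil> = 1 \<or> 2 \<le> \<lceil>t / L\<rceil>" by linarith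
    then have "k t = 1 \<or> 2 \<le> k t" unfolding k_def by linarith
    moreover have "\<phi> 0 = 0" by (simp add: \<phi>_def)
    ultimately have "0 \<le> \<phi> (k t - 1)"
      using pos[of "k t - 1"] k(2)[OF that] by auto
    then show "\<alpha> t \<le> 1" using pos[of "k t"] k[OF that] by (simp add: \<alpha>_def)
  qed
  \<comment> \<open>\<beta> = 4 sin^2 \<theta> - \<alpha> is at least -1. Uniform bounds on the
    weights are what makes the weighted squares integrable.\<close>
  have \<beta>1: "\<bar>\<beta> t\<bar> \<le> 1" if "0 < t" "t < T" for t
    using \<beta>[OF that] \<alpha>\<beta>[OF that] \<alpha>[OF that] by (smt (verit) zero_le_power2)
  have \<alpha>1: "\<bar>\<alpha> t\<bar> \<le> 1" if "0 < t" "t < T" for t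
    using \<alpha>[OF that] by simp
  have "\<alpha> \<in> borel_measurable borel" "\<beta> \<in> borel_measurable borel"
    unfolding \<alpha>_def[abs_def] \<beta>_def[abs_def] \<phi>_def k_def by measurable
  then have \<alpha>\<beta>_meas: "\<alpha> \<in> borel_measurable ?M" "\<beta> \<in> borel_measurable ?M"
    by (auto intro!: measurable_restrict_space1 measurable_completion)
  have int: "integrable ?M (\<lambda>t. c t * (u t)\<^sup>2)" 
    if "u \<in> L2 T" and [measurable]: "c \<in> borel_measurable ?M" and "\<And>t. 0 < t \<Longrightarrow> t < T \<Longrightarrow> \<bar>c t\<bar> \<le> 1" for c u
  proof (rule Bochner_Integration.integrable_bound[OF L2_D(2)[OF that(1)]])
    have [measurable]: "u \<in> borel_measurable ?M" by (rule L2_D(1)[OF that(1)])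
    show "(\<lambda>t. c t * (u t)\<^sup>2) \<in> borel_measurable ?M" by measurable
    show "AE t in ?M. norm (c t * (u t)\<^sup>2) \<le> norm ((u t)\<^sup>2)"
      using that(3) by (intro AE_I2) (auto simp: abs_mult intro!: mult_left_le_one_le)
  qed
  have main: "(LINT t|?M. \<alpha> t * (u t)\<^sup>2) + (LINT t|?M. \<beta> t * (v t)\<^sup>2) \<le> (LINT t|?M. (u t + delay L v t)\<^sup>2)"
    if u: "u \<in> L2 T" and v: "v \<in> L2 T" for u v
  proof -
    note ia = int[OF u \<alpha>\<beta>_meas(1) \<alpha>1] and ib = int[OF v \<alpha>\<beta>_meas(2) \<beta>1]
    note d = delay_integral[OF ib \<open>L > 0\<close>]
    have "(LINT t|?M. \<beta> t * (v t)\<^sup>2) \<le> (LINT t|?M. indicator {..<T-L} t * (\<beta> t * (v t)\<^sup>2))"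
    proof (rule integral_mono[OF ib integrable_interval_indicator[OF ib]])
      fix t assume "t \<in> space ?M"
      then have "\<beta> t * (v t)\<^sup>2 \<le> 0" using \<beta>[of t] by (simp add: mult_nonpos_nonneg)
      then show "\<beta> t * (v t)\<^sup>2 \<le> indicator {..<T-L} t * (\<beta> t * (v t)\<^sup>2)" by (simp add: indicator_def)
    qed measurable
    then have "(LINT t|?M. \<alpha> t * (u t)\<^sup>2) + (LINT t|?M. \<beta> t * (v t)\<^sup>2) 
      \<le> (LINT t|?M. \<alpha> t * (u t)\<^sup>2 + delay L (\<lambda>t. \<beta> t * (v t)\<^sup>2) t)"
      using d ia by simp
    also have "\<dots> \<le> (LINT t|?M. (u t + delay L v t)\<^sup>2)"
    proof (rule integral_mono)
      show "integrable ?M (\<lambda>t. \<alpha> t * (u t)\<^sup>2 + delay L (\<lambda>t. \<beta> t * (v t)\<^sup>2) t)"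
        using d ia by simp
      show "integrable ?M (\<lambda>t. (u t + delay L v t)\<^sup>2)"
        using L2_D(2)[OF L2_lincomb[OF u delay_L2[OF v \<open>L > 0\<close>], of 1 1]] by simp
      fix t assume "t \<in> space ?M"
      then have t: "0 < t" "t < T" by auto
      show "\<alpha> t * (u t)\<^sup>2 + delay L (\<lambda>t. \<beta> t * (v t)\<^sup>2) t \<le> (u t + delay L v t)\<^sup>2"
      proof (cases "L < t")
        case True
        have k': "k (t - L) = k t - 1"
          using \<open>L > 0\<close> by (simp add: k_def diff_divide_distrib)
        have p: "\<phi> (k t) > 0" "\<phi> (k t - 1) > 0"
          using pos k[OF t] k[of "t - L"] True t \<open>L > 0\<close> k' by auto
        show ?thesis
          using square_sum_weighted_ge[OF p(2) p(1), of "u t" "v (t - L)"] True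
          by (simp add: delay_def \<alpha>_def \<beta>_def k' mult.commute)
      next
        case False
        then have "\<alpha> t * (u t)\<^sup>2 \<le> 1 * (u t)\<^sup>2"
          using \<alpha>[OF t] by (intro mult_right_mono) auto
        then show ?thesis using False by (simp add: delay_def)
      qed
    qed
    finally show ?thesis .
  qed
  have L: "fst f \<in> L2 T" "snd f \<in> L2 T" using f by (auto simp: L2_Sigma_def)
  have comb: "(LINT t|?M. \<alpha> t * (u t)\<^sup>2) + (LINT t|?M. \<beta> t * (u t)\<^sup>2) = 4 * (sin \<theta>)\<^sup>2 * (L2_norm T u)\<^sup>2"
    if u: "u \<in> L2 T" for u
  proof -
    have "(LINT t|?M. \<alpha> t * (u t)\<^sup>2) + (LINT t|?M. \<beta> t * (u t)\<^sup>2) = (LINT t|?M. \<alpha> t * (u t)\<^sup>2 + \<beta> t * (u t)\<^sup>2)"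
      using int[OF u \<alpha>\<beta>_meas(1) \<alpha>1] int[OF u \<alpha>\<beta>_meas(2) \<beta>1] by simp
    also have "\<dots> = (LINT t|?M. 4 * (sin \<theta>)\<^sup>2 * (u t)\<^sup>2)"
    proof (rule Bochner_Integration.integral_cong)
      fix t assume "t \<in> space ?M"
      then show "\<alpha> t * (u t)\<^sup>2 + \<beta> t * (u t)\<^sup>2 = 4 * (sin \<theta>)\<^sup>2 * (u t)\<^sup>2"
        using \<alpha>\<beta>[of t] by (simp add: distrib_right[symmetric])
    qed simp
    finally show ?thesis by (simp add: L2_norm_sq L2_inner_self)
  qed
  have quarter: "(L2_norm T (\<lambda>t. 1/2 * u t + 1/2 * delay L v t))\<^sup>2 = 1/4 * (LINT t|?M. (u t + delay L v t)\<^sup>2)" for u v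
  proof -
    have "(1/2 * u t + 1/2 * delay L v t)\<^sup>2 = 1/4 * (u t + delay L v t)\<^sup>2" for t
      by (simp add: power2_eq_square algebra_simps)
    then show ?thesis by (simp only: L2_norm_sq L2_inner_self integral_mult_right_zero)
  qed
  have "(L2_Sigma_norm T (delay_sum L f))\<^sup>2 
     = 1/4 * (LINT t|?M. (fst f t + delay L (snd f) t)\<^sup>2) + 1/4 * (LINT t|?M. (snd f t + delay L (fst f) t)\<^sup>2)"
    using quarter[of "fst f" "snd f"] quarter[of "snd f" "fst f"]
    by (simp add: L2_Sigma_norm_def delay_sum_def add.commute)
  moreover have "(c_S n)\<^sup>2 * (L2_Sigma_norm T f)\<^sup>2 = (sin \<theta>)\<^sup>2 * (L2_norm T (fst f))\<^sup>2 + (sin \<theta>)\<^sup>2 * (L2_norm T (snd f))\<^sup>2"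
    by (simp add: L2_Sigma_norm_def c_S_def \<theta>_def algebra_simps)
  ultimately show ?thesis
    using main[OF L(1) L(2)] main[OF L(2) L(1)] comb[OF L(1)] comb[OF L(2)] by simp
qed

section \<open>The dual space and the single layer operator\<close>

lemma L2_Sigma_D: "u \<in> L2_Sigma T \<Longrightarrow> fst u \<in> L2 T" "u \<in> L2_Sigma T \<Longrightarrow> snd u \<in> L2 T"
  by (auto simp: L2_Sigma_def)

lemma L2_Sigma_norm_nonneg [simp]: "0 \<le> L2_Sigma_norm T u"
  by (simp add: L2_Sigma_norm_def)

lemma L2_Sigma_norm_sq: "(L2_Sigma_norm T u)\<^sup>2 = L2_Sigma_inner T u u"
  by (simp add: L2_Sigma_norm_def L2_Sigma_inner_def L2_norm_sq)

lemma L2_Sigma_lincomb: "u \<in> L2_Sigma T \<Longrightarrow> v \<in> L2_Sigma T \<Longrightarrow> lincomb a u b v \<in> L2_Sigma T"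
  by (auto simp: L2_Sigma_def lincomb_def intro: L2_lincomb)

lemma L2_Sigma_inner_lincomb_right:
  assumes "u \<in> L2_Sigma T" "v \<in> L2_Sigma T" "h \<in> L2_Sigma T"
  shows "L2_Sigma_inner T h (lincomb a u b v) = a * L2_Sigma_inner T h u + b * L2_Sigma_inner T h v"
  using assms[THEN L2_Sigma_D(1)] assms[THEN L2_Sigma_D(2)]
  by (simp add: L2_Sigma_inner_def lincomb_def L2_inner_lincomb_right algebra_simps)

lemma L2_Sigma_inner_commute: "L2_Sigma_inner T u v = L2_Sigma_inner T v u"
  by (simp add: L2_Sigma_inner_def L2_inner_commute)

lemma L2_Sigma_inner_lincomb_left:
  assumes "u \<in> L2_Sigma T" "v \<in> L2_Sigma T" "h \<in> L2_Sigma T"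
  shows "L2_Sigma_inner T (lincomb a u b v) h = a * L2_Sigma_inner T u h + b * L2_Sigma_inner T v h"
  using L2_Sigma_inner_lincomb_right[OF assms] by (simp add: L2_Sigma_inner_commute)

lemma L2_Sigma_Cauchy_Schwarz:
  assumes "u \<in> L2_Sigma T" "v \<in> L2_Sigma T"
  shows "\<bar>L2_Sigma_inner T u v\<bar> \<le> L2_Sigma_norm T u * L2_Sigma_norm T v"
proof -
  let ?a = "L2_norm T (fst u)" and ?b = "L2_norm T (snd u)" and ?c = "L2_norm T (fst v)" and ?d = "L2_norm T (snd v)"
  have "\<bar>L2_Sigma_inner T u v\<bar> \<le> ?a * ?c + ?b * ?d"
    using L2_Cauchy_Schwarz[OF assms[THEN L2_Sigma_D(1)]] L2_Cauchy_Schwarz[OF assms[THEN L2_Sigma_D(2)]]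
    unfolding L2_Sigma_inner_def by linarith
  also have "\<dots> = sqrt ((?a * ?c + ?b * ?d)\<^sup>2)" by simp
  also have "\<dots> \<le> sqrt ((?a\<^sup>2 + ?b\<^sup>2) * (?c\<^sup>2 + ?d\<^sup>2))"
  proof (rule real_sqrt_le_mono)
    have "(?a\<^sup>2 + ?b\<^sup>2) * (?c\<^sup>2 + ?d\<^sup>2) - (?a * ?c + ?b * ?d)\<^sup>2 = (?a * ?d - ?b * ?c)\<^sup>2"
      by (simp add: power2_eq_square algebra_simps)
    then show "(?a * ?c + ?b * ?d)\<^sup>2 \<le> (?a\<^sup>2 + ?b\<^sup>2) * (?c\<^sup>2 + ?d\<^sup>2)"
      using zero_le_power2[of "?a * ?d - ?b * ?c"] by linarith
  qed
  finally show ?thesis by (simp add: L2_Sigma_norm_def real_sqrt_mult)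
qed

lemma L2_Sigma_norm_eq_0_iff:
  assumes "u \<in> L2_Sigma T"
  shows "L2_Sigma_norm T u = 0 \<longleftrightarrow> eq_AE T u (\<lambda>_. 0, \<lambda>_. 0)"
  using L2_norm_eq_0_iff[OF L2_Sigma_D(1)[OF assms]] L2_norm_eq_0_iff[OF L2_Sigma_D(2)[OF assms]]
  by (auto simp: L2_Sigma_norm_def eq_AE_def)

lemma L2_Sigma_norm_cong:
  assumes "eq_AE T u v" "u \<in> L2_Sigma T" "v \<in> L2_Sigma T"
  shows "L2_Sigma_norm T u = L2_Sigma_norm T v"
proof -
  have "AE t in interval_measure T. fst u t = fst v t" "AE t in interval_measure T. snd u t = snd v t"
    using assms(1) by (auto simp: eq_AE_def)
  then have "L2_norm T (fst u) = L2_norm T (fst v)" "L2_norm T (snd u) = L2_norm T (snd v)"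
    using assms(2,3)[THEN L2_Sigma_D(1)] assms(2,3)[THEN L2_Sigma_D(2)] by (simp_all only: L2_norm_cong)
  then show ?thesis by (simp add: L2_Sigma_norm_def)
qed

lemma L2_Sigma_norm_triangle:
  assumes "u \<in> L2_Sigma T" "v \<in> L2_Sigma T" "z \<in> L2_Sigma T"
  shows "L2_Sigma_norm T (lincomb 1 u (-1) z) \<le> L2_Sigma_norm T (lincomb 1 u (-1) v) + L2_Sigma_norm T (lincomb 1 v (-1) z)"
proof -
  let ?a = "L2_norm T (\<lambda>t. fst u t - fst v t)" and ?b = "L2_norm T (\<lambda>t. snd u t - snd v t)" 
    and ?c = "L2_norm T (\<lambda>t. fst v t - fst z t)" and ?d = "L2_norm T (\<lambda>t. snd v t - snd z t)"
  have "L2_Sigma_norm T (lincomb 1 u (-1) z) \<le> sqrt ((?a + ?c)\<^sup>2 + (?b + ?d)\<^sup>2)"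
    using L2_norm_triangle_diff[OF assms[THEN L2_Sigma_D(1)]] L2_norm_triangle_diff[OF assms[THEN L2_Sigma_D(2)]]
    unfolding L2_Sigma_norm_def lincomb_def by (intro real_sqrt_le_mono add_mono power_mono) auto
  also have "\<dots> \<le> sqrt (?a\<^sup>2 + ?b\<^sup>2) + sqrt (?c\<^sup>2 + ?d\<^sup>2)" by (rule real_sqrt_sum_squares_triangle_ineq)
  finally show ?thesis by (simp add: L2_Sigma_norm_def lincomb_def)
qed

lemma eq_AE_iff_norm_diff:
  assumes "u \<in> L2_Sigma T" "v \<in> L2_Sigma T"
  shows "eq_AE T u v \<longleftrightarrow> L2_Sigma_norm T (lincomb 1 u (-1) v) = 0"
  using L2_Sigma_norm_eq_0_iff[OF L2_Sigma_lincomb[OF assms, of 1 "-1"]]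
  by (simp add: eq_AE_def lincomb_def)

lemma eq_AE_sym: "eq_AE T u v \<Longrightarrow> eq_AE T v u"
  unfolding eq_AE_def by (auto elim: eventually_mono)

lemma eq_AE_trans:
  assumes "eq_AE T u v" "eq_AE T v z" shows "eq_AE T u z"
  using assms unfolding eq_AE_def by eventually_elim simp

section \<open>Derivatives and primitives of pairs, and representation of the dual\<close>

definition Sigma_deriv :: "real \<Rightarrow> bdry \<Rightarrow> bdry" where
  "Sigma_deriv T v = (weak_deriv T (fst v), weak_deriv T (snd v))"

lemma H1_Sigma_norm_eq: "H1_Sigma_norm T v = L2_Sigma_norm T (Sigma_deriv T v)"
  by (simp add: H1_Sigma_norm_def L2_Sigma_norm_def Sigma_deriv_def)

lemma Sigma_deriv_L2: "v \<in> H1_Sigma T \<Longrightarrow> Sigma_deriv T v \<in> L2_Sigma T"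
  by (auto simp: H1_Sigma_def Sigma_deriv_def L2_Sigma_def H1_end_D)

lemma H1_Sigma_lincomb:
  assumes "u \<in> H1_Sigma T" "v \<in> H1_Sigma T" "T > 0"
  shows "lincomb a u b v \<in> H1_Sigma T"
    "eq_AE T (Sigma_deriv T (lincomb a u b v)) (lincomb a (Sigma_deriv T u) b (Sigma_deriv T v))"
proof -
  have *: "fst u \<in> H1_end T" "snd u \<in> H1_end T" "fst v \<in> H1_end T" "snd v \<in> H1_end T"
    using assms by (auto simp: H1_Sigma_def)
  show "lincomb a u b v \<in> H1_Sigma T"
    using * H1_end_lincomb(1) \<open>T > 0\<close> by (auto simp: H1_Sigma_def lincomb_def)
  show "eq_AE T (Sigma_deriv T (lincomb a u b v)) (lincomb a (Sigma_deriv T u) b (Sigma_deriv T v))"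
    using H1_end_lincomb(2)[OF *(1,3) \<open>T > 0\<close>, of a b] H1_end_lincomb(2)[OF *(2,4) \<open>T > 0\<close>, of a b]
    unfolding eq_AE_def Sigma_deriv_def lincomb_def by eventually_elim simp
qed

definition Sigma_primitive :: "real \<Rightarrow> bdry \<Rightarrow> bdry" where
  "Sigma_primitive T g = (end_primitive T (fst g), end_primitive T (snd g))"

lemma Sigma_primitive_H1:
  assumes "g \<in> L2_Sigma T" "T > 0"
  shows "Sigma_primitive T g \<in> H1_Sigma T" "eq_AE T (Sigma_deriv T (Sigma_primitive T g)) g"
proof -
  note e = end_primitive_H1_end[OF L2_Sigma_D(1)[OF assms(1)] assms(2)] 
    end_primitive_H1_end[OF L2_Sigma_D(2)[OF assms(1)] assms(2)]
  show "Sigma_primitive T g \<in> H1_Sigma T" using e by (auto simp: H1_Sigma_def Sigma_primitive_def)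
  show "eq_AE T (Sigma_deriv T (Sigma_primitive T g)) g"
    using e(2) e(4) unfolding eq_AE_def Sigma_deriv_def Sigma_primitive_def by eventually_elim simp
qed

text \<open>The choice of weak derivative for the zero function is not literally zero, only of norm
  0. Needed to embed each component as a pair with zero partner.\<close>

lemma H1_end_zero: 
  assumes "T > 0"
  shows "(\<lambda>_. 0) \<in> H1_end T" "L2_norm T (weak_deriv T (\<lambda>_. 0)) = 0"
proof -
  have *: "end_primitive T (\<lambda>_. 0) = (\<lambda>_. 0)" by (simp add: end_primitive_def[abs_def] primitive_def)
  show "(\<lambda>_. 0) \<in> H1_end T" using end_primitive_H1_end(1)[of "\<lambda>_. 0" T] assms by (simp add: *)
  then have "weak_deriv T (\<lambda>_. 0) \<in> L2 T" by (rule H1_end_D)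
  then show "L2_norm T (weak_deriv T (\<lambda>_. 0)) = 0"
    using end_primitive_H1_end(2)[of "\<lambda>_. 0" T] assms by (simp add: * L2_norm_eq_0_iff)
qed

lemma L2_Sigma_inner_cong:
  assumes "eq_AE T u v" "u \<in> L2_Sigma T" "v \<in> L2_Sigma T" "f \<in> L2_Sigma T"
  shows "L2_Sigma_inner T f u = L2_Sigma_inner T f v"
proof -
  have "AE t in interval_measure T. fst u t = fst v t" "AE t in interval_measure T. snd u t = snd v t"
    using assms(1) by (auto simp: eq_AE_def)
  then show ?thesis
    using L2_inner_cong[of "fst f" "fst f" T "fst u" "fst v"] L2_inner_cong[of "snd f" "snd f" T "snd u" "snd v"]
      assms(2-4) by (simp add: L2_Sigma_inner_def L2_Sigma_D)
qed

text \<open>Used contrapositively: an element with nonzero derivative is itself nonzero and hence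
  admissible in the supremum defining \<open>dual_norm\<close>.\<close>

lemma weak_deriv_AE_zero:
  assumes v: "v \<in> H1_end T" and ae: "AE t in interval_measure T. v t = 0" and "T > 0"
  shows "AE t in interval_measure T. weak_deriv T v t = 0"
proof -
  note d = H1_end_D[OF v]
  have "has_weak_deriv T v (\<lambda>_. 0)"
    unfolding has_weak_deriv_def
  proof
    fix \<phi> assume \<phi>: "\<phi> \<in> test_functions T"
    have "deriv \<phi> \<in> L2 T" by (rule test_function_props(1)[OF \<phi> \<open>T > 0\<close>])
    then have "L2_inner T v (deriv \<phi>) = L2_inner T (\<lambda>_. 0) (deriv \<phi>)"
      using d ae by (intro L2_inner_cong) auto
    then show "L2_inner T v (deriv \<phi>) = - L2_inner T (\<lambda>_. 0) \<phi>" by (simp add: L2_inner_def)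
  qed
  then show ?thesis by (rule has_weak_deriv_unique[OF weak_deriv_props(2)[OF d(1)] _ d(3) L2_zero])
qed

text \<open>The functional is pulled back to L^2 along \<open>end_primitive\<close>, where its bound
  becomes the L^2 norm, and \<open>L2_Riesz\<close> applies with the whole of \<open>L2 T\<close>.
  The minus sign is the one from integration by parts.\<close>

lemma H1_end_Riesz:
  assumes lin: "\<And>u v a b. u \<in> H1_end T \<Longrightarrow> v \<in> H1_end T \<Longrightarrow> \<omega> (\<lambda>t. a * u t + b * v t) = a * \<omega> u + b * \<omega> v"
    and bdd: "\<And>v. v \<in> H1_end T \<Longrightarrow> \<bar>\<omega> v\<bar> \<le> C * L2_norm T (weak_deriv T v)"
    and "T > 0"
  shows "\<exists>f \<in> L2 T. \<forall>v \<in> H1_end T. \<omega> v = - L2_inner T f (weak_deriv T v)"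
proof -
  \<comment> \<open>The bound by the derivative forces \<omega> to vanish where the derivative does;
    with linearity, \<omega> depends only on the derivative up to null sets.\<close>
  have cong: "\<omega> u = \<omega> v" if u: "u \<in> H1_end T" and v: "v \<in> H1_end T" 
    and ae: "AE t in interval_measure T. weak_deriv T u t = weak_deriv T v t" for u v
  proof -
    note l = H1_end_lincomb[OF u v \<open>T > 0\<close>, of 1 "-1"]
    have "AE t in interval_measure T. weak_deriv T (\<lambda>t. 1 * u t + (-1) * v t) t = 0"
      using l(2) ae by eventually_elim simp
    then have "L2_norm T (weak_deriv T (\<lambda>t. 1 * u t + (-1) * v t)) = 0"
      using H1_end_D(3)[OF l(1)] by (simp add: L2_norm_eq_0_iff)
    then have "\<omega> (\<lambda>t. 1 * u t + (-1) * v t) = 0" using bdd[OF l(1)] by simp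
    then show ?thesis using lin[OF u v, of 1 "-1"] by simp
  qed
  note J = end_primitive_H1_end[OF _ \<open>T > 0\<close>]
  have "\<exists>p d. p \<in> L2 T \<and> (\<forall>i::nat. d i \<in> L2 T) \<and> (\<lambda>i. L2_norm T (\<lambda>t. d i t - p t)) \<longlonglongrightarrow> 0 \<and>
     (\<forall>g \<in> L2 T. L2_inner T p g = - \<omega> (end_primitive T g))"
  proof (rule L2_Riesz)
    fix a b f g assume fg: "f \<in> L2 T" "g \<in> L2 T"
    have "\<omega> (end_primitive T (\<lambda>t. a * f t + b * g t)) = \<omega> (\<lambda>t. a * end_primitive T f t + b * end_primitive T g t)"
    proof (rule cong)
      show "AE t in interval_measure T. weak_deriv T (end_primitive T (\<lambda>t. a * f t + b * g t)) t =
        weak_deriv T (\<lambda>t. a * end_primitive T f t + b * end_primitive T g t) t"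
        using J(2)[OF L2_lincomb[OF fg, of a b]] J(2)[OF fg(1)] J(2)[OF fg(2)]
          H1_end_lincomb(2)[OF J(1)[OF fg(1)] J(1)[OF fg(2)] \<open>T > 0\<close>, of a b]
        by eventually_elim simp
    qed (intro J(1) L2_lincomb fg H1_end_lincomb \<open>T > 0\<close>)+
    then show "- \<omega> (end_primitive T (\<lambda>t. a * f t + b * g t)) = a * - \<omega> (end_primitive T f) + b * - \<omega> (end_primitive T g)"
      using lin[OF J(1)[OF fg(1)] J(1)[OF fg(2)], of a b] by simp
  next
    fix g assume g: "g \<in> L2 T"
    show "\<bar>- \<omega> (end_primitive T g)\<bar> \<le> C * L2_norm T g"
      using bdd[OF J(1)[OF g]] L2_norm_cong[OF J(2)[OF g] H1_end_D(3)[OF J(1)[OF g]] g] by simp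
  next
    show "L2 T \<noteq> {}" using L2_zero by blast
  qed (use \<open>T > 0\<close> in \<open>auto intro: L2_lincomb\<close>)
  then obtain p where p: "p \<in> L2 T" "\<And>g. g \<in> L2 T \<Longrightarrow> L2_inner T p g = - \<omega> (end_primitive T g)" by blast
  have "\<omega> v = - L2_inner T p (weak_deriv T v)" if v: "v \<in> H1_end T" for v
  proof -
    note d = H1_end_D(3)[OF v]
    have "\<omega> v = \<omega> (end_primitive T (weak_deriv T v))"
      by (rule cong[OF v J(1)[OF d]]) (use J(2)[OF d] in \<open>auto elim: eventually_mono\<close>)
    then show ?thesis using p(2)[OF d] by simp
  qed
  then show ?thesis using p(1) by blast
qed

text \<open>Formally, \<open>w\<close> is the distributional derivative of \<open>f\<close>, with \<open>f = 0\<close> at time 0.\<close>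

definition represents :: "real \<Rightarrow> bdry \<Rightarrow> (bdry \<Rightarrow> real) \<Rightarrow> bool" where
  "represents T f w \<longleftrightarrow> f \<in> L2_Sigma T \<and> (\<forall>v \<in> H1_Sigma T. w v = - L2_Sigma_inner T f (Sigma_deriv T v))"

text \<open>A pair is the sum of (p, 0) and (0, q), so the scalar Riesz statement is applied to each
  component separately.\<close>

lemma dual_Sigma_represented:
  assumes w: "w \<in> dual_Sigma T" and "T > 0"
  shows "\<exists>f. represents T f w"
proof -
  let ?z = "\<lambda>_. 0 :: real"
  have lin: "w (lincomb a u b v) = a * w u + b * w v" if "u \<in> H1_Sigma T" "v \<in> H1_Sigma T" for u v a b
    using w that by (auto simp: dual_Sigma_def)
  obtain C where C: "\<And>v. v \<in> H1_Sigma T \<Longrightarrow> \<bar>w v\<bar> \<le> C * H1_Sigma_norm T v"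
    using w unfolding dual_Sigma_def by blast
  note z = H1_end_zero[OF \<open>T > 0\<close>]
  have "\<exists>f \<in> L2 T. \<forall>v \<in> H1_end T. w (v, ?z) = - L2_inner T f (weak_deriv T v)"
  proof (rule H1_end_Riesz)
    show "w (\<lambda>t. a * u t + b * v t, ?z) = a * w (u, ?z) + b * w (v, ?z)" if "u \<in> H1_end T" "v \<in> H1_end T" for u v a b
      using lin[of "(u, ?z)" "(v, ?z)" a b] that z by (simp add: lincomb_def H1_Sigma_def)
    show "\<bar>w (v, ?z)\<bar> \<le> C * L2_norm T (weak_deriv T v)" if "v \<in> H1_end T" for v
      using C[of "(v, ?z)"] that z by (simp add: H1_Sigma_def H1_Sigma_norm_def)
  qed fact
  then obtain f where f: "f \<in> L2 T" "\<And>v. v \<in> H1_end T \<Longrightarrow> w (v, ?z) = - L2_inner T f (weak_deriv T v)" by blast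
  have "\<exists>f \<in> L2 T. \<forall>v \<in> H1_end T. w (?z, v) = - L2_inner T f (weak_deriv T v)"
  proof (rule H1_end_Riesz)
    show "w (?z, \<lambda>t. a * u t + b * v t) = a * w (?z, u) + b * w (?z, v)" if "u \<in> H1_end T" "v \<in> H1_end T" for u v a b
      using lin[of "(?z, u)" "(?z, v)" a b] that z by (simp add: lincomb_def H1_Sigma_def)
    show "\<bar>w (?z, v)\<bar> \<le> C * L2_norm T (weak_deriv T v)" if "v \<in> H1_end T" for v
      using C[of "(?z, v)"] that z by (simp add: H1_Sigma_def H1_Sigma_norm_def)
  qed fact
  then obtain g where g: "g \<in> L2 T" "\<And>v. v \<in> H1_end T \<Longrightarrow> w (?z, v) = - L2_inner T g (weak_deriv T v)" by blast
  have "w v = - L2_Sigma_inner T (f, g) (Sigma_deriv T v)" if v: "v \<in> H1_Sigma T" for v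
  proof -
    obtain p q where pq: "v = (p, q)" "p \<in> H1_end T" "q \<in> H1_end T" using v by (auto simp: H1_Sigma_def)
    have "w v = w (p, ?z) + w (?z, q)"
      using lin[of "(p, ?z)" "(?z, q)" 1 1] pq z by (simp add: lincomb_def H1_Sigma_def)
    then show ?thesis using f(2)[OF pq(2)] g(2)[OF pq(3)] by (simp add: L2_Sigma_inner_def Sigma_deriv_def pq(1))
  qed
  then show ?thesis using f(1) g(1) by (auto simp: represents_def L2_Sigma_def)
qed

lemma represents_dual_Sigma:
  assumes f: "represents T f w" and "T > 0"
  shows "w \<in> dual_Sigma T"
proof -
  have fL: "f \<in> L2_Sigma T" and w: "\<And>v. v \<in> H1_Sigma T \<Longrightarrow> w v = - L2_Sigma_inner T f (Sigma_deriv T v)"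
    using f by (auto simp: represents_def)
  have "w (lincomb a u b v) = a * w u + b * w v" if u: "u \<in> H1_Sigma T" and v: "v \<in> H1_Sigma T" for u v a b
  proof -
    note l = H1_Sigma_lincomb[OF u v \<open>T > 0\<close>, of a b] and d = Sigma_deriv_L2[OF u] Sigma_deriv_L2[OF v]
    have "w (lincomb a u b v) = - L2_Sigma_inner T f (lincomb a (Sigma_deriv T u) b (Sigma_deriv T v))"
      using w[OF l(1)] L2_Sigma_inner_cong[OF l(2) Sigma_deriv_L2[OF l(1)] L2_Sigma_lincomb[OF d] fL] by simp
    then show ?thesis by (simp add: L2_Sigma_inner_lincomb_right d fL w u v)
  qed
  moreover have "\<bar>w v\<bar> \<le> L2_Sigma_norm T f * H1_Sigma_norm T v" if "v \<in> H1_Sigma T" for v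
    using L2_Sigma_Cauchy_Schwarz[OF fL Sigma_deriv_L2[OF that]] w[OF that] by (simp add: H1_Sigma_norm_eq)
  ultimately show ?thesis unfolding dual_Sigma_def by blast
qed

lemma represents_lincomb:
  assumes "represents T f w" "represents T g z"
  shows "represents T (lincomb a f b g) (\<lambda>v. a * w v + b * z v)"
  using assms Sigma_deriv_L2 
  by (auto simp: represents_def L2_Sigma_lincomb L2_Sigma_inner_lincomb_left)

text \<open>The functional is evaluated at the primitive of f - g, whose derivative is f - g
  again.\<close>

lemma represents_unique:
  assumes "represents T f w" "represents T g w" "T > 0"
  shows "eq_AE T f g"
proof -
  let ?d = "lincomb 1 f (-1) g"
  have L: "f \<in> L2_Sigma T" "g \<in> L2_Sigma T" using assms by (auto simp: represents_def)
  have d: "?d \<in> L2_Sigma T" by (rule L2_Sigma_lincomb[OF L])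
  note J = Sigma_primitive_H1[OF d \<open>T > 0\<close>]
  have "L2_Sigma_inner T f (Sigma_deriv T (Sigma_primitive T ?d)) = L2_Sigma_inner T g (Sigma_deriv T (Sigma_primitive T ?d))"
    using assms J(1) by (auto simp: represents_def)
  then have "L2_Sigma_inner T f ?d = L2_Sigma_inner T g ?d"
    using L2_Sigma_inner_cong[OF J(2) Sigma_deriv_L2[OF J(1)] d] L by simp
  then have "L2_Sigma_inner T ?d ?d = 0" using L2_Sigma_inner_lincomb_left[OF L d, of 1 "-1"] by simp
  then show ?thesis
    using eq_AE_iff_norm_diff[OF L] L2_Sigma_norm_sq[of T ?d] by simp
qed

text \<open>Integration by parts without boundary terms: the primitive vanishes at 0 and the test
  element at T. This ties the representation to the explicit formula for the operator.\<close>

lemma represents_L2: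
  assumes w: "w \<in> L2_Sigma T" and "T > 0"
  shows "represents T (primitive (fst w), primitive (snd w)) (L2_Sigma_inner T w)"
proof -
  have *: "L2_inner T a v = - L2_inner T (primitive a) (weak_deriv T v)" if a: "a \<in> L2 T" and v: "v \<in> H1_end T" for a v
  proof -
    let ?g = "weak_deriv T v"
    note d = H1_end_D[OF v]
    have "L2_inner T a v = L2_inner T a (\<lambda>t. 1 * primitive ?g t + (- primitive ?g T) * 1)"
    proof (rule L2_inner_cong)
      show "AE t in interval_measure T. v t = 1 * primitive ?g t + (- primitive ?g T) * 1"
        using H1_end_eq_primitive[OF v \<open>T > 0\<close>] by simp
      show "(\<lambda>t. 1 * primitive ?g t + (- primitive ?g T) * 1) \<in> L2 T"
        by (rule L2_lincomb[OF primitive_L2[OF d(3)] L2_const])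
    qed (use a d in auto)
    also have "\<dots> = L2_inner T a (primitive ?g) - primitive ?g T * primitive a T"
      by (subst L2_inner_lincomb_right[OF primitive_L2[OF d(3)] L2_const a]) 
        (simp add: L2_inner_def[of _ a "\<lambda>_. 1"] primitive_def[of a T])
    also have "\<dots> = - L2_inner T (primitive a) ?g"
      using primitive_by_parts[OF a d(3)] by (simp add: mult.commute)
    finally show ?thesis .
  qed
  show ?thesis
    using w unfolding represents_def
    by (auto simp: L2_Sigma_inner_def Sigma_deriv_def L2_Sigma_def H1_Sigma_def primitive_L2 *)
qed

text \<open>Cauchy-Schwarz gives one inequality; for nonzero \<open>f\<close> the supremum is
  attained at the primitive of -f.\<close>

lemma dual_norm_represented:
  assumes f: "represents T f w" and "T > 0"
  shows "dual_norm T w = L2_Sigma_norm T f"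
proof -
  let ?z = "(\<lambda>_. 0, \<lambda>_. 0) :: bdry"
  let ?S = "{v \<in> H1_Sigma T. \<not> eq_AE T v ?z}"
  have fL: "f \<in> L2_Sigma T" and w: "\<And>v. v \<in> H1_Sigma T \<Longrightarrow> w v = - L2_Sigma_inner T f (Sigma_deriv T v)"
    using f by (auto simp: represents_def)
  \<comment> \<open>Division by zero yields 0, so the bound also holds where the seminorm
    vanishes.\<close>
  have le: "w v / H1_Sigma_norm T v \<le> L2_Sigma_norm T f" if "v \<in> H1_Sigma T" for v
  proof (cases "H1_Sigma_norm T v = 0")
    case False
    then have "H1_Sigma_norm T v > 0" by (simp add: H1_Sigma_norm_eq less_le)
    moreover have "w v \<le> L2_Sigma_norm T f * H1_Sigma_norm T v"
      using L2_Sigma_Cauchy_Schwarz[OF fL Sigma_deriv_L2[OF that]] w[OF that]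
      by (simp add: H1_Sigma_norm_eq)
    ultimately show ?thesis by (simp add: divide_le_eq)
  qed simp
  have bdd: "bdd_above ((\<lambda>v. w v / H1_Sigma_norm T v) ` ?S)"
    using le by (intro bdd_aboveI[of _ "L2_Sigma_norm T f"]) auto
  have ex: "Sigma_primitive T g \<in> ?S" if g: "g \<in> L2_Sigma T" "L2_Sigma_norm T g \<noteq> 0" for g
  proof -
    note J = Sigma_primitive_H1[OF g(1) \<open>T > 0\<close>]
    let ?v = "Sigma_primitive T g"
    have "\<not> eq_AE T ?v ?z"
    proof
      assume z: "eq_AE T ?v ?z"
      then have v0: "AE t in interval_measure T. fst ?v t = 0" "AE t in interval_measure T. snd ?v t = 0"
        by (auto simp: eq_AE_def)
      have "fst ?v \<in> H1_end T" "snd ?v \<in> H1_end T" using J(1) by (auto simp: H1_Sigma_def)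
      then have "AE t in interval_measure T. weak_deriv T (fst ?v) t = 0" "AE t in interval_measure T. weak_deriv T (snd ?v) t = 0"
        using v0 \<open>T > 0\<close> by (simp_all only: weak_deriv_AE_zero)
      then have "eq_AE T (Sigma_deriv T ?v) ?z" by (simp add: eq_AE_def Sigma_deriv_def)
      then have "eq_AE T g ?z" using eq_AE_trans[OF eq_AE_sym[OF J(2)]] by blast
      then show False using g L2_Sigma_norm_eq_0_iff by blast
    qed
    then show ?thesis using J(1) by simp
  qed
  have H: "w (Sigma_primitive T g) / H1_Sigma_norm T (Sigma_primitive T g) = - L2_Sigma_inner T f g / L2_Sigma_norm T g"
    if g: "g \<in> L2_Sigma T" for g
  proof -
    note J = Sigma_primitive_H1[OF g(1) \<open>T > 0\<close>] and d = Sigma_deriv_L2[OF J(1)]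
    show ?thesis
      using w[OF J(1)] L2_Sigma_inner_cong[OF J(2) d g fL] L2_Sigma_norm_cong[OF J(2) d g]
      by (simp add: H1_Sigma_norm_eq)
  qed
  \<comment> \<open>A fixed admissible direction: it makes the index set of the supremum nonempty,
    and its quotient 0 settles the lower bound when \<open>f\<close> has norm 0.\<close>
  have one: "(\<lambda>_. 1, \<lambda>_. 1) \<in> L2_Sigma T" "L2_Sigma_norm T (\<lambda>_. 1, \<lambda>_. 1) \<noteq> 0"
    using \<open>T > 0\<close> by (auto simp: L2_Sigma_def L2_Sigma_norm_def L2_norm_sq L2_inner_self measure_restrict_space)
  have "dual_norm T w \<le> L2_Sigma_norm T f"
    unfolding dual_norm_def by (rule cSUP_least) (use ex[OF one] le in blast)+
  moreover have "L2_Sigma_norm T f \<le> dual_norm T w"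
  proof (cases "L2_Sigma_norm T f = 0")
    case True
    have "\<bar>L2_Sigma_inner T f (\<lambda>_. 1, \<lambda>_. 1)\<bar> \<le> 0" 
      using L2_Sigma_Cauchy_Schwarz[OF fL one(1)] True by simp
    then have "0 = w (Sigma_primitive T (\<lambda>_. 1, \<lambda>_. 1)) / H1_Sigma_norm T (Sigma_primitive T (\<lambda>_. 1, \<lambda>_. 1))"
      using H[OF one(1)] by simp
    also have "\<dots> \<le> dual_norm T w"
      unfolding dual_norm_def by (rule cSUP_upper[OF ex[OF one] bdd])
    finally show ?thesis using True by simp
  next
    case False
    \<comment> \<open>The sign compensates the minus in the representation.\<close>
    let ?g = "lincomb (-1) f 0 f"
    have g: "?g \<in> L2_Sigma T" by (rule L2_Sigma_lincomb[OF fL fL])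
    have i: "L2_Sigma_inner T f ?g = - L2_Sigma_inner T f f"
      using L2_Sigma_inner_lincomb_right[OF fL fL fL, of "-1" 0] by simp
    have "L2_Sigma_inner T ?g ?g = L2_Sigma_inner T f f"
      using L2_Sigma_inner_lincomb_left[OF fL fL g, of "-1" 0] i by simp
    then have n: "L2_Sigma_norm T ?g = L2_Sigma_norm T f"
      by (metis L2_Sigma_norm_sq L2_Sigma_norm_nonneg power2_eq_imp_eq)
    have "L2_Sigma_norm T f = w (Sigma_primitive T ?g) / H1_Sigma_norm T (Sigma_primitive T ?g)"
      using H[OF g] False by (simp add: i n L2_Sigma_norm_sq[symmetric] power2_eq_square)
    also have "\<dots> \<le> dual_norm T w"
      unfolding dual_norm_def by (rule cSUP_upper[OF ex[OF g] bdd]) (use False n in simp)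
    finally show ?thesis .
  qed
  ultimately show ?thesis by simp
qed

section \<open>Existence and uniqueness of the extended operator\<close>

definition representative :: "real \<Rightarrow> (bdry \<Rightarrow> real) \<Rightarrow> bdry" where
  "representative T w = (SOME f. represents T f w)"

lemma represents_representative:
  "w \<in> dual_Sigma T \<Longrightarrow> T > 0 \<Longrightarrow> represents T (representative T w) w"
  unfolding representative_def using dual_Sigma_represented by (rule someI_ex)

text \<open>\<open>V_op\<close> is chosen by \<open>SOME\<close>, so a witness is required before
  any property of it can be derived. Representatives are unique up to null sets, which gives
  linearity and agreement with \<open>V_L2\<close> almost everywhere.\<close>

lemma V_extension_exists:
  assumes "L > 0" "T > 0"
  shows "V_extension L T (\<lambda>w. delay_sum L (representative T w))"
  unfolding V_extension_def
proof (intro conjI ballI allI exI)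
  note r = represents_representative[OF _ \<open>T > 0\<close>]
  have rL: "representative T w \<in> L2_Sigma T" if "w \<in> dual_Sigma T" for w
    using r[OF that] by (simp add: represents_def)
  show "delay_sum L (representative T w) \<in> L2_Sigma T" if "w \<in> dual_Sigma T" for w
    by (intro delay_sum_L2 rL that \<open>L > 0\<close>)
  show "eq_AE T (delay_sum L (representative T (\<lambda>v. a * w v + b * z v)))
      (lincomb a (delay_sum L (representative T w)) b (delay_sum L (representative T z)))"
    if w: "w \<in> dual_Sigma T" and z: "z \<in> dual_Sigma T" for w z a b
  proof -
    have l: "represents T (lincomb a (representative T w) b (representative T z)) (\<lambda>v. a * w v + b * z v)"
      by (intro represents_lincomb r w z)
    note d = represents_dual_Sigma[OF l \<open>T > 0\<close>]
    show ?thesis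
      unfolding delay_sum_lincomb[symmetric]
      by (intro delay_sum_cong_AE represents_unique[OF r[OF d] l] L2_Sigma_lincomb rL d w z assms)
  qed
  show "L2_Sigma_norm T (delay_sum L (representative T w)) \<le> 1 * dual_norm T w" if w: "w \<in> dual_Sigma T" for w
    using L2_Sigma_norm_delay_sum_le[OF rL[OF w] \<open>L > 0\<close>] dual_norm_represented[OF r[OF w] \<open>T > 0\<close>] by simp
  show "eq_AE T (delay_sum L (representative T (L2_Sigma_inner T w))) (V_L2 L w)" if w: "w \<in> L2_Sigma T" for w
  proof -
    note l = represents_L2[OF w \<open>T > 0\<close>]
    note d = represents_dual_Sigma[OF l \<open>T > 0\<close>]
    show ?thesis
      unfolding V_L2_eq_delay_sum
      using l by (intro delay_sum_cong_AE represents_unique[OF r[OF d] l] rL d assms) (simp add: represents_def)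
  qed
qed

text \<open>By \<open>L2_Riesz\<close> there is a limit \<open>p\<close> of bumps such that p - f is
  orthogonal to every bump, hence zero almost everywhere. A bump is the primitive of its own
  derivative. Through \<open>represents_L2\<close> this is the density of L^2 in the dual.\<close>

lemma L2_primitive_dense:
  assumes f: "f \<in> L2 T" and "T > 0"
  obtains a where "\<And>i::nat. a i \<in> L2 T" "(\<lambda>i. L2_norm T (\<lambda>t. f t - primitive (a i) t)) \<longlonglongrightarrow> 0"
proof -
  have "\<exists>p d. p \<in> L2 T \<and> (\<forall>i::nat. d i \<in> {\<phi>. bump T \<phi>}) \<and> (\<lambda>i. L2_norm T (\<lambda>t. d i t - p t)) \<longlonglongrightarrow> 0 \<and>
     (\<forall>\<phi> \<in> {\<phi>. bump T \<phi>}. L2_inner T p \<phi> = L2_inner T f \<phi>)"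
  proof (rule L2_Riesz)
    \<comment> \<open>The support interval is the empty {1..0}, which satisfies both bounds for
      every positive T.\<close>
    have "bump T (\<lambda>_. 0)"
      using \<open>T > 0\<close> unfolding bump_def by (auto intro: elem_smooth.const exI[of _ 1] exI[of _ 0])
    then show "{\<phi>. bump T \<phi>} \<noteq> {}" by blast
    show "\<bar>L2_inner T f \<phi>\<bar> \<le> L2_norm T f * L2_norm T \<phi>" if "\<phi> \<in> {\<phi>. bump T \<phi>}" for \<phi>
      using L2_Cauchy_Schwarz[OF f bump_L2] that by simp
  qed (use f \<open>T > 0\<close> in \<open>auto simp: bump_L2 bump_lincomb L2_inner_lincomb_right\<close>)
  then obtain p d where p: "p \<in> L2 T" and d: "\<And>i::nat. bump T (d i)" "(\<lambda>i. L2_norm T (\<lambda>t. d i t - p t)) \<longlonglongrightarrow> 0"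
    and pf: "\<And>\<phi>. bump T \<phi> \<Longrightarrow> L2_inner T p \<phi> = L2_inner T f \<phi>" by auto
  have ae: "AE t in interval_measure T. p t - f t = 0"
    by (rule L2_fundamental_lemma[OF L2_diff[OF p f]]) (simp add: L2_inner_diff_left p f bump_L2 pf)
  note t = test_function_props[OF bump_test_function[OF d(1)] \<open>T > 0\<close>]
  show ?thesis
  proof (rule that)
    show "deriv (d i) \<in> L2 T" for i by (rule t)
    have "L2_norm T (\<lambda>t. f t - primitive (deriv (d i)) t) = L2_norm T (\<lambda>t. p t - d i t)" for i
    proof (rule L2_norm_cong)
      have "AE t in interval_measure T. primitive (deriv (d i)) t = d i t"
        by (intro AE_I2) (simp add: t)
      then show "AE t in interval_measure T. f t - primitive (deriv (d i)) t = p t - d i t"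
        using ae by eventually_elim simp
    qed (intro L2_diff primitive_L2 t f p)+
    then show "(\<lambda>i. L2_norm T (\<lambda>t. f t - primitive (deriv (d i)) t)) \<longlonglongrightarrow> 0"
      using d(2) by (simp add: L2_norm_diff_commute)
  qed
qed

text \<open>Two bounded linear maps that agree on a dense set coincide. The dual norm of a
  difference of functionals is the L^2 norm of the difference of representatives, so approximating
  \<open>f\<close> by primitives approximates \<open>w\<close> in the dual.\<close>

lemma V_extension_eq_delay_sum:
  assumes V: "V_extension L T V" and f: "represents T f w" and "L > 0" "T > 0"
  shows "eq_AE T (V w) (delay_sum L f)"
proof -
  have fL: "f \<in> L2_Sigma T" using f by (simp add: represents_def)
  have w: "w \<in> dual_Sigma T" by (rule represents_dual_Sigma[OF f \<open>T > 0\<close>])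
  obtain C where VL: "\<And>w. w \<in> dual_Sigma T \<Longrightarrow> V w \<in> L2_Sigma T"
    and lin: "\<And>w z a b. w \<in> dual_Sigma T \<Longrightarrow> z \<in> dual_Sigma T \<Longrightarrow>
        eq_AE T (V (\<lambda>v. a * w v + b * z v)) (lincomb a (V w) b (V z))"
    and bd: "\<And>w. w \<in> dual_Sigma T \<Longrightarrow> L2_Sigma_norm T (V w) \<le> C * dual_norm T w"
    and ext: "\<And>w. w \<in> L2_Sigma T \<Longrightarrow> eq_AE T (V (L2_Sigma_inner T w)) (V_L2 L w)"
    using V unfolding V_extension_def by blast
  obtain a where a: "\<And>i::nat. a i \<in> L2 T" "(\<lambda>i. L2_norm T (\<lambda>t. fst f t - primitive (a i) t)) \<longlonglongrightarrow> 0"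
    using L2_primitive_dense[OF L2_Sigma_D(1)[OF fL] \<open>T > 0\<close>] by blast
  obtain b where b: "\<And>i::nat. b i \<in> L2 T" "(\<lambda>i. L2_norm T (\<lambda>t. snd f t - primitive (b i) t)) \<longlonglongrightarrow> 0"
    using L2_primitive_dense[OF L2_Sigma_D(2)[OF fL] \<open>T > 0\<close>] by blast
  define F where "F i = (primitive (a i), primitive (b i))" for i
  define \<omega> where "\<omega> i = L2_Sigma_inner T (a i, b i)" for i
  have ab: "(a i, b i) \<in> L2_Sigma T" for i using a b by (simp add: L2_Sigma_def)
  have \<omega>: "represents T (F i) (\<omega> i)" for i
    using represents_L2[OF ab \<open>T > 0\<close>] by (simp add: F_def \<omega>_def)
  have FL: "F i \<in> L2_Sigma T" for i using \<omega> by (simp add: represents_def)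
  have \<omega>d: "\<omega> i \<in> dual_Sigma T" for i by (rule represents_dual_Sigma[OF \<omega> \<open>T > 0\<close>])
  have lim: "(\<lambda>i. L2_Sigma_norm T (lincomb 1 f (-1) (F i))) \<longlonglongrightarrow> 0"
  proof -
    have "(\<lambda>i. sqrt ((L2_norm T (\<lambda>t. fst f t - primitive (a i) t))\<^sup>2 + (L2_norm T (\<lambda>t. snd f t - primitive (b i) t))\<^sup>2)) \<longlonglongrightarrow> sqrt (0\<^sup>2 + 0\<^sup>2)"
      by (intro tendsto_intros a b)
    then show ?thesis by (simp add: L2_Sigma_norm_def lincomb_def F_def)
  qed
  note dL = delay_sum_L2[OF fL \<open>L > 0\<close>] and dF = delay_sum_L2[OF FL \<open>L > 0\<close>]
  \<comment> \<open>The path goes from V w over V (\<omega> i) and the delayed sum of F i to that of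
    \<open>f\<close>. The first piece costs the bound C, the middle one is 0 because \<omega> i
    comes from L^2, and the last costs 1.\<close>
  have le: "L2_Sigma_norm T (lincomb 1 (V w) (-1) (delay_sum L f)) \<le> (C + 1) * L2_Sigma_norm T (lincomb 1 f (-1) (F i))" for i
  proof -
    let ?n = "L2_Sigma_norm T (lincomb 1 f (-1) (F i))"
    have diff: "represents T (lincomb 1 f (-1) (F i)) (\<lambda>v. 1 * w v + (-1) * \<omega> i v)"
      by (rule represents_lincomb[OF f \<omega>])
    note dd = represents_dual_Sigma[OF diff \<open>T > 0\<close>]
    have "L2_Sigma_norm T (lincomb 1 (V w) (-1) (V (\<omega> i))) = L2_Sigma_norm T (V (\<lambda>v. 1 * w v + (-1) * \<omega> i v))"
      by (rule L2_Sigma_norm_cong[OF eq_AE_sym[OF lin[OF w \<omega>d]]]) (intro L2_Sigma_lincomb VL w \<omega>d dd)+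
    also have "\<dots> \<le> C * ?n" using bd[OF dd] dual_norm_represented[OF diff \<open>T > 0\<close>] by simp
    finally have 1: "L2_Sigma_norm T (lincomb 1 (V w) (-1) (V (\<omega> i))) \<le> C * ?n" .
    have "eq_AE T (V (\<omega> i)) (delay_sum L (F i))"
      using ext[OF ab[of i]] by (simp add: \<omega>_def F_def V_L2_eq_delay_sum)
    then have 2: "L2_Sigma_norm T (lincomb 1 (V (\<omega> i)) (-1) (delay_sum L (F i))) = 0"
      using eq_AE_iff_norm_diff[OF VL[OF \<omega>d] dF] by simp
    have "L2_Sigma_norm T (lincomb 1 (delay_sum L (F i)) (-1) (delay_sum L f)) \<le> L2_Sigma_norm T (lincomb 1 (F i) (-1) f)"
      unfolding delay_sum_lincomb[symmetric] by (intro L2_Sigma_norm_delay_sum_le L2_Sigma_lincomb FL fL \<open>L > 0\<close>)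
    also have "\<dots> = ?n"
      by (simp add: L2_Sigma_norm_def lincomb_def L2_norm_diff_commute[of T "fst (F i)"] L2_norm_diff_commute[of T "snd (F i)"])
    finally have 3: "L2_Sigma_norm T (lincomb 1 (delay_sum L (F i)) (-1) (delay_sum L f)) \<le> ?n" .
    have "L2_Sigma_norm T (lincomb 1 (V w) (-1) (delay_sum L f)) \<le> L2_Sigma_norm T (lincomb 1 (V w) (-1) (V (\<omega> i)))
      + L2_Sigma_norm T (lincomb 1 (V (\<omega> i)) (-1) (delay_sum L f))"
      by (rule L2_Sigma_norm_triangle[OF VL[OF w] VL[OF \<omega>d] dL])
    also have "L2_Sigma_norm T (lincomb 1 (V (\<omega> i)) (-1) (delay_sum L f)) 
      \<le> L2_Sigma_norm T (lincomb 1 (V (\<omega> i)) (-1) (delay_sum L (F i))) + L2_Sigma_norm T (lincomb 1 (delay_sum L (F i)) (-1) (delay_sum L f))"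
      by (rule L2_Sigma_norm_triangle[OF VL[OF \<omega>d] dF dL])
    finally show ?thesis using 1 2 3 by (simp add: algebra_simps)
  qed
  have "L2_Sigma_norm T (lincomb 1 (V w) (-1) (delay_sum L f)) \<le> (C + 1) * 0"
    by (rule LIMSEQ_le_const[OF tendsto_mult_left[OF lim]]) (use le in blast)
  then have "L2_Sigma_norm T (lincomb 1 (V w) (-1) (delay_sum L f)) = 0"
    using L2_Sigma_norm_nonneg[of T "lincomb 1 (V w) (-1) (delay_sum L f)"] by linarith
  then show ?thesis using eq_AE_iff_norm_diff[OF VL[OF w] dL] by simp
qed

lemma time_slices_bound:
  assumes "L > 0" shows "T \<le> real (time_slices L T) * L"
  unfolding time_slices_def
proof (rule LeastI_ex)
  obtain m :: nat where "T / L \<le> real m" using real_arch_simple by blast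
  then show "\<exists>m. T \<le> real m * L" using assms by (auto simp: field_simps)
qed

theorem theorem2p3:
  fixes L T :: real and n :: nat and w :: "bdry \<Rightarrow> real"
  assumes "L > 0" and "T > 0"
    and "n = time_slices L T"
    and "w \<in> dual_Sigma T"
  shows "(L2_Sigma_norm T (V_op L T w))\<^sup>2 \<ge> (c_S n)\<^sup>2 * (dual_norm T w)\<^sup>2"
proof -
  have V: "V_extension L T (V_op L T)"
    unfolding V_op_def by (rule someI[of "V_extension L T", OF V_extension_exists[OF assms(1,2)]])
  obtain f where f: "represents T f w" using dual_Sigma_represented[OF assms(4,2)] by blast
  then have fL: "f \<in> L2_Sigma T" by (simp add: represents_def)
  have "V_op L T w \<in> L2_Sigma T" using V assms(4) by (simp add: V_extension_def)
  then have "L2_Sigma_norm T (V_op L T w) = L2_Sigma_norm T (delay_sum L f)"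
    by (rule L2_Sigma_norm_cong[OF V_extension_eq_delay_sum[OF V f assms(1,2)] _ delay_sum_L2[OF fL assms(1)]])
  then show ?thesis
    using delay_sum_lower_bound[OF fL assms(1,2), of n] time_slices_bound[OF assms(1), of T] 
      dual_norm_represented[OF f assms(2)] assms(3) by simp
qed

end
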